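(* Let $T$ be a finite tree with root $r$ and positive edge weights, let $B>1$ be a real number, and assume that every vertex of $T$ is at distance at most $B/2$ from $r$. Fix an arbitrary depth first search traversal $R_{\mathrm{DFS}}$ of $T$, and let $\mathrm{PDFS}(T)$ be the DFS $B$-exploration obtained from $R_{\mathrm{DFS}}$. Let $\mathcal{R}$ be a $B$-exploration strategy for $T$ with the minimum possible number of routes. Then the number of routes of $\mathrm{PDFS}(T)$ is at most $10$ times the number of routes of $\mathcal{R}$.
   Context: Distances $d(u,v)$ are sums of edge weights along the tree path. A route is a sequence of vertices $(v_0,\dots,v_l)$ with $v_0=v_l=r$ and $\{v_i,v_{i+1}\}$ an edge for all $i$; its length is the sum of the weights of its consecutive edges. A $B$-exploration strategy is a finite sequence of routes, each of length at most $B$, such that every vertex of $T$ is visited by some route. A depth first search traversal $R_{\mathrm{DFS}}=(v_0,v_1,\dots,v_l)$ is a route (with repetitions) performing a depth first search of $T$ from $r$, visiting all vertices. The DFS $B$-exploration $\mathrm{PDFS}(T)=(R_1,\dots,R_k)$ is defined iteratively: $j_0=0$; given $j_{i-1}$, let $j_i$ be the largest index $p\le l$, $p\ge j_{i-1}$, such that $d(r,v_{j_{i-1}})+\mathrm{len}(v_{j_{i-1}},v_{j_{i-1}+1},\dots,v_p)+d(v_p,r)\le B$; then $R_i$ is the tree path from $r$ to $v_{j_{i-1}}$, followed by the walk $(v_{j_{i-1}},\dots,v_{j_i})$, followed by the tree path from $v_{j_i}$ back to $r$. The process stops (defining $k$) once $j_i=l$. *)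

theory Defs
  imports Complex_Main
begin

definition simple_graph :: "'a set \<Rightarrow> 'a set set \<Rightarrow> bool" where
  "simple_graph V E \<longleftrightarrow> E \<subseteq> {{u, v} | u v. u \<in> V \<and> v \<in> V \<and> u \<noteq> v}"

definition is_walk :: "'a set \<Rightarrow> 'a set set \<Rightarrow> 'a list \<Rightarrow> bool" where
  "is_walk V E p \<longleftrightarrow> p \<noteq> [] \<and> set p \<subseteq> V \<and> successively (\<lambda>u v. {u, v} \<in> E) p"

definition is_path_between :: "'a set \<Rightarrow> 'a set set \<Rightarrow> 'a \<Rightarrow> 'a list \<Rightarrow> 'a \<Rightarrow> bool" where
  "is_path_between V E u p v \<longleftrightarrow> is_walk V E p \<and> distinct p \<and> hd p = u \<and> last p = v"

definition connected_graph :: "'a set \<Rightarrow> 'a set set \<Rightarrow> bool" where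
  "connected_graph V E \<longleftrightarrow>
     V \<noteq> {} \<and> (\<forall>u\<in>V. \<forall>v\<in>V. \<exists>p. is_walk V E p \<and> hd p = u \<and> last p = v)"

definition is_cycle :: "'a set \<Rightarrow> 'a set set \<Rightarrow> 'a list \<Rightarrow> bool" where
  "is_cycle V E c \<longleftrightarrow>
     is_walk V E c \<and> distinct c \<and> length c \<ge> 3 \<and> {last c, hd c} \<in> E"

definition finite_tree :: "'a set \<Rightarrow> 'a set set \<Rightarrow> bool" where
  "finite_tree V E \<longleftrightarrow>
     finite V \<and> simple_graph V E \<and> connected_graph V E \<and> (\<nexists>c. is_cycle V E c)"

text \<open>Only meaningful in a tree, where the path between two vertices exists and is unique.\<close>

definition tree_path :: "'a set \<Rightarrow> 'a set set \<Rightarrow> 'a \<Rightarrow> 'a \<Rightarrow> 'a list" where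
  "tree_path V E u v = (THE p. is_path_between V E u p v)"

definition walk_len :: "('a set \<Rightarrow> real) \<Rightarrow> 'a list \<Rightarrow> real" where
  "walk_len w p = (\<Sum>i<length p - 1. w {p ! i, p ! Suc i})"

definition tree_dist :: "'a set \<Rightarrow> 'a set set \<Rightarrow> ('a set \<Rightarrow> real) \<Rightarrow> 'a \<Rightarrow> 'a \<Rightarrow> real" where
  "tree_dist V E w u v = walk_len w (tree_path V E u v)"

definition is_route :: "'a set \<Rightarrow> 'a set set \<Rightarrow> 'a \<Rightarrow> 'a list \<Rightarrow> bool" where
  "is_route V E r p \<longleftrightarrow> is_walk V E p \<and> hd p = r \<and> last p = r"

definition exploration_strategy ::
    "'a set \<Rightarrow> 'a set set \<Rightarrow> ('a set \<Rightarrow> real) \<Rightarrow> 'a \<Rightarrow> real \<Rightarrow> 'a list list \<Rightarrow> bool" where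
  "exploration_strategy V E w r B Rs \<longleftrightarrow>
     (\<forall>p\<in>set Rs. is_route V E r p \<and> walk_len w p \<le> B) \<and>
     (\<forall>v\<in>V. \<exists>p\<in>set Rs. v \<in> set p)"

definition min_exploration_strategy ::
    "'a set \<Rightarrow> 'a set set \<Rightarrow> ('a set \<Rightarrow> real) \<Rightarrow> 'a \<Rightarrow> real \<Rightarrow> 'a list list \<Rightarrow> bool" where
  "min_exploration_strategy V E w r B Rs \<longleftrightarrow>
     exploration_strategy V E w r B Rs \<and>
     (\<forall>Rs'. exploration_strategy V E w r B Rs' \<longrightarrow> length Rs \<le> length Rs')"

text \<open>
  In \<open>dfs_state E r vs st\<close>, the list \<open>vs\<close> is the sequence of positions of a depth first search
  so far (with repetitions), and \<open>st\<close> is its stack, whose head is the current vertex. From the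
  current vertex the search goes to an arbitrary unvisited neighbour if there is one, and
  otherwise back to the vertex from which the current one was discovered.
\<close>

inductive dfs_state :: "'a set set \<Rightarrow> 'a \<Rightarrow> 'a list \<Rightarrow> 'a list \<Rightarrow> bool"
  for E :: "'a set set" and r :: 'a where
  start: "dfs_state E r [r] [r]"
| descend: "dfs_state E r vs (u # st) \<Longrightarrow> {u, v} \<in> E \<Longrightarrow> v \<notin> set vs \<Longrightarrow>
    dfs_state E r (vs @ [v]) (v # u # st)"
| backtrack: "dfs_state E r vs (u # u' # st) \<Longrightarrow> (\<forall>v. {u, v} \<in> E \<longrightarrow> v \<in> set vs) \<Longrightarrow>
    dfs_state E r (vs @ [u']) (u' # st)"

definition dfs_traversal :: "'a set \<Rightarrow> 'a set set \<Rightarrow> 'a \<Rightarrow> 'a list \<Rightarrow> bool" where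
  "dfs_traversal V E r vs \<longleftrightarrow>
     is_route V E r vs \<and> dfs_state E r vs [r] \<and> set vs = V"

definition segment :: "'a list \<Rightarrow> nat \<Rightarrow> nat \<Rightarrow> 'a list" where
  "segment vs a b = map ((!) vs) [a..<Suc b]"

text \<open>
  With \<open>vs = (v\<^sub>0, \<dots>, v\<^sub>l)\<close>, so \<open>l = length vs - 1\<close>, the value at \<open>i\<close> is \<open>j\<^sub>i\<close>. If every vertex has
  distance at most \<open>B / 2\<close> from \<open>r\<close>, then \<open>p = j\<close> is always admissible, so the maximum exists.
\<close>

primrec pdfs_index ::
    "'a set \<Rightarrow> 'a set set \<Rightarrow> ('a set \<Rightarrow> real) \<Rightarrow> 'a \<Rightarrow> real \<Rightarrow> 'a list \<Rightarrow> nat \<Rightarrow> nat" where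
  "pdfs_index V E w r B vs 0 = 0"
| "pdfs_index V E w r B vs (Suc i) =
     (let j = pdfs_index V E w r B vs i in
      GREATEST p. j \<le> p \<and> p \<le> length vs - 1 \<and>
        tree_dist V E w r (vs ! j) + walk_len w (segment vs j p)
          + tree_dist V E w (vs ! p) r \<le> B)"

text \<open>
  At least one route is always constructed, so that also the one-vertex tree, where
  \<open>j\<^sub>0 = l = 0\<close>, is explored (by the trivial route).
\<close>

definition pdfs_count ::
    "'a set \<Rightarrow> 'a set set \<Rightarrow> ('a set \<Rightarrow> real) \<Rightarrow> 'a \<Rightarrow> real \<Rightarrow> 'a list \<Rightarrow> nat" where
  "pdfs_count V E w r B vs =
     (LEAST k. 1 \<le> k \<and> pdfs_index V E w r B vs k = length vs - 1)"

text \<open>Consecutive pieces share an endpoint, which \<open>tl\<close> prevents from being listed twice.\<close>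

definition pdfs_route ::
    "'a set \<Rightarrow> 'a set set \<Rightarrow> ('a set \<Rightarrow> real) \<Rightarrow> 'a \<Rightarrow> real \<Rightarrow> 'a list \<Rightarrow> nat \<Rightarrow> 'a list" where
  "pdfs_route V E w r B vs i =
     (let a = pdfs_index V E w r B vs (i - 1); b = pdfs_index V E w r B vs i in
      tree_path V E r (vs ! a) @ tl (segment vs a b) @ tl (tree_path V E (vs ! b) r))"

definition pdfs ::
    "'a set \<Rightarrow> 'a set set \<Rightarrow> ('a set \<Rightarrow> real) \<Rightarrow> 'a \<Rightarrow> real \<Rightarrow> 'a list \<Rightarrow> 'a list list" where
  "pdfs V E w r B vs =
     map (pdfs_route V E w r B vs) [1..<Suc (pdfs_count V E w r B vs)]"

end

theory Submission
  imports Defs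
begin

text \<open>
  Let \<open>H = B / 2\<close>, call \<open>H - d(r, v)\<close> the slack of \<open>v\<close>, and let \<open>p\<close> be the weight ascended in the current
  piece of the greedy exploration. The potential ``number of cuts plus \<open>p\<close> divided by the slack of the
  current vertex'' never decreases along the traversal; its increases are charged to the edges, each of
  which is traversed once in either direction. For a route of the optimal strategy, the weight it covers
  below \<open>v\<close> divided by the slack of \<open>v\<close> increases towards the root as well, up to a total of at most 1.
  On an edge from slack \<open>x\<close> to slack \<open>z > x > 0\<close> both kinds of increase are multiples of
  \<open>1 / x - 1 / z\<close>, apart from the effect of a cut, which only lowers the former.

  Edges whose greedy increase is at most 4 times that of the \<open>K\<close> routes contribute at most \<open>4 K\<close>. On any
  other edge every route using it is more than half exhausted below it, so the sets of routes at such
  edges form a laminar family, with at most \<open>2 K - 1\<close> members. The edges belonging to one member lie on a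
  path, and contribute at most 3 together. Hence there are at most
  \<open>4 K + 3 (2 K - 1) < 10 K\<close> cuts.
\<close>

section \<open>Greedy partition of a height profile\<close>

text \<open>
  The greedy exploration depends only on the heights \<open>h t = d(r, v\<^sub>t)\<close>. Since the tour of a piece from
  \<open>a\<close> to \<open>t\<close> has length \<open>2 h t\<close> plus twice the weight ascended since \<open>a\<close>, it suffices to track the
  latter, and with \<open>H = B / 2\<close> a new piece starts when the next descent would push the sum above \<open>H\<close>.
\<close>

primrec backlog :: "real \<Rightarrow> (nat \<Rightarrow> real) \<Rightarrow> nat \<Rightarrow> real" where
  "backlog H h 0 = 0"
| "backlog H h (Suc t) =
     (if h t < h (Suc t) then (if backlog H h t + h (Suc t) > H then 0 else backlog H h t)
      else backlog H h t + (h t - h (Suc t)))"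

definition is_cut :: "real \<Rightarrow> (nat \<Rightarrow> real) \<Rightarrow> nat \<Rightarrow> bool" where
  "is_cut H h t \<longleftrightarrow> h t < h (Suc t) \<and> backlog H h t + h (Suc t) > H"

definition ncuts :: "real \<Rightarrow> (nat \<Rightarrow> real) \<Rightarrow> nat \<Rightarrow> nat" where
  "ncuts H h t = card {i. i < t \<and> is_cut H h i}"

lemma ncuts_0 [simp]: "ncuts H h 0 = 0"
  by (simp add: ncuts_def)

lemma ncuts_Suc: "ncuts H h (Suc t) = ncuts H h t + (if is_cut H h t then 1 else 0)"
proof -
  have "{i. i < Suc t \<and> is_cut H h i} =
      {i. i < t \<and> is_cut H h i} \<union> (if is_cut H h t then {t} else {})"
    by (auto simp: less_Suc_eq)
  then show ?thesis
    by (auto simp: ncuts_def)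
qed

lemma backlog_Suc:
  "backlog H h (Suc t) =
     (if is_cut H h t then 0 else backlog H h t + max 0 (h t - h (Suc t)))"
  by (auto simp: is_cut_def)

declare backlog.simps(2) [simp del]

lemma backlog_nonneg: "0 \<le> backlog H h t"
  by (induction t) (auto simp: backlog_Suc)

text \<open>A fall moves weight from the height to the backlog, and a rise that would push their sum
  above \<open>H\<close> is a cut, which clears the backlog.\<close>

lemma backlog_le:
  assumes "\<And>i. i \<le> L \<Longrightarrow> h i \<le> H" and "h 0 = 0" "t \<le> L"
  shows "backlog H h t \<le> H - h t"
  using assms(3)
proof (induction t)
  case 0
  then show ?case using assms(1)[of 0] by simp
next
  case (Suc t)
  then show ?case using assms(1)[of "Suc t"] by (auto simp: backlog_Suc is_cut_def)
qed

lemma ncuts_diff: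
  assumes "i \<le> k"
  shows "ncuts H h k = ncuts H h i + card {t \<in> {i..<k}. is_cut H h t}"
proof -
  have "card ({t. t < i \<and> is_cut H h t} \<union> {t \<in> {i..<k}. is_cut H h t}) =
      card {t. t < i \<and> is_cut H h t} + card {t \<in> {i..<k}. is_cut H h t}"
    by (rule card_Un_disjoint) auto
  moreover have "{t. t < i \<and> is_cut H h t} \<union> {t \<in> {i..<k}. is_cut H h t} = {t. t < k \<and> is_cut H h t}"
    using assms by auto
  ultimately show ?thesis
    by (simp only: ncuts_def)
qed

lemma ncuts_no_cut:
  assumes "i \<le> k" "\<And>t. i \<le> t \<Longrightarrow> t < k \<Longrightarrow> \<not> is_cut H h t"
  shows "ncuts H h k = ncuts H h i"
proof -
  have "{t \<in> {i..<k}. is_cut H h t} = {}" using assms(2) by auto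
  then show ?thesis using ncuts_diff[OF assms(1), of H h] by (metis add_0_right card.empty)
qed

lemma ncuts_one_cut:
  assumes "i \<le> k"
    and "\<And>t t'. i \<le> t \<Longrightarrow> t < t' \<Longrightarrow> t' < k \<Longrightarrow> is_cut H h t \<Longrightarrow> is_cut H h t' \<Longrightarrow> False"
  shows "ncuts H h k \<le> ncuts H h i + 1"
proof -
  have "card {t \<in> {i..<k}. is_cut H h t} \<le> Suc 0"
  proof (rule card_le_Suc0_iff_eq[THEN iffD2], simp, intro ballI)
    fix t t' assume "t \<in> {t \<in> {i..<k}. is_cut H h t}" "t' \<in> {t \<in> {i..<k}. is_cut H h t}"
    then show "t = t'"
      using assms(2)[of t t'] assms(2)[of t' t] by (cases t t' rule: linorder_cases) auto
  qed
  then show ?thesis using ncuts_diff[OF assms(1), of H h] by simp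
qed

text \<open>As long as heights stay at most \<open>H\<close>, the backlog vanishes at height
  \<open>H\<close>, so the quotient there is the harmless default \<open>0 / 0 = 0\<close>.\<close>

definition cut_pot :: "real \<Rightarrow> (nat \<Rightarrow> real) \<Rightarrow> nat \<Rightarrow> real" where
  "cut_pot H h t = real (ncuts H h t) + backlog H h t / (H - h t)"

lemma backlog_ratio:
  assumes "\<And>i. i \<le> L \<Longrightarrow> h i \<le> H" and "h 0 = 0" "t \<le> L"
  shows "0 \<le> backlog H h t / (H - h t)" "backlog H h t / (H - h t) \<le> 1"
  using backlog_nonneg[of H h t] backlog_le[of L h H t] assms
  by (auto simp: divide_le_eq_1)

text \<open>A cut adds 1 to the count and drops a quotient that is at most 1. Any other rise only
  shrinks the denominator. A fall adds the same amount to numerator and denominator of a fraction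
  that is at most 1.\<close>

lemma cut_pot_mono_Suc:
  assumes H: "\<And>i. i \<le> L \<Longrightarrow> h i \<le> H" and "h 0 = 0" "Suc t \<le> L"
  shows "cut_pot H h t \<le> cut_pot H h (Suc t)"
proof -
  define p where "p = backlog H h t"
  have p: "0 \<le> p" "p \<le> H - h t"
    using backlog_nonneg[of H h t] backlog_le[of L h H t] assms by (auto simp: p_def)
  have hs: "h (Suc t) \<le> H" "h t \<le> H" using H assms(3) by auto
  show ?thesis
  proof (cases "is_cut H h t")
    case True
    then show ?thesis
      using backlog_ratio(1)[of L h H "Suc t"] backlog_ratio(2)[of L h H t] assms
      by (simp add: cut_pot_def ncuts_Suc backlog_Suc)
  next
    case nc: False
    have "p / (H - h t) \<le> backlog H h (Suc t) / (H - h (Suc t))"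
    proof (cases "h t < h (Suc t)")
      case up: True
      then have "p \<le> H - h (Suc t)" using nc by (auto simp: is_cut_def p_def)
      moreover have "backlog H h (Suc t) = p" using nc up by (simp add: backlog_Suc p_def)
      ultimately show ?thesis
        using p hs up by (cases "H = h (Suc t)") (auto intro!: divide_left_mono)
    next
      case False
      have b: "backlog H h (Suc t) = p + (h t - h (Suc t))"
        using nc False by (auto simp: backlog_Suc p_def)
      show ?thesis
      proof (cases "H = h t")
        case True
        then show ?thesis using p b False hs by auto
      next
        case F2: False
        have "p * (H - h (Suc t)) = p * (H - h t) + p * (h t - h (Suc t))" by (simp add: algebra_simps)
        also have "\<dots> \<le> p * (H - h t) + (H - h t) * (h t - h (Suc t))"
          using p False by (intro add_left_mono mult_right_mono) auto
        finally show ?thesis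
          unfolding b using F2 hs False by (simp add: divide_simps) (simp add: algebra_simps)
      qed
    qed
    then show ?thesis using nc by (simp add: cut_pot_def ncuts_Suc p_def)
  qed
qed

text \<open>
  A subinterval of a feasible interval is feasible, so no sequence of cuts gets ahead of the greedy one.
\<close>

lemma greedy_index_le:
  fixes h :: "nat \<Rightarrow> real" and len :: "nat \<Rightarrow> nat \<Rightarrow> real" and idx :: "nat \<Rightarrow> nat"
  assumes H: "\<And>i. i \<le> L \<Longrightarrow> h i \<le> H" and h0: "h 0 = 0"
    and len_self: "\<And>a. len a a = 0"
    and len_Suc: "\<And>a i. a \<le> i \<Longrightarrow> Suc i \<le> L \<Longrightarrow> len a (Suc i) = len a i + \<bar>h (Suc i) - h i\<bar>"
    and idx0: "idx 0 = 0"
    and idxS: "\<And>m. idx m \<le> L \<Longrightarrow> idx (Suc m) =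
      (GREATEST p. idx m \<le> p \<and> p \<le> L \<and> h (idx m) + len (idx m) p + h p \<le> 2 * H)"
  shows "\<exists>m. 1 \<le> m \<and> m \<le> Suc (ncuts H h L) \<and> idx m = L"
proof -
  have step: "idx m \<le> idx (Suc m) \<and> idx (Suc m) \<le> L" if "idx m \<le> L" for m
  proof -
    have "idx m \<le> idx (Suc m) \<and> idx (Suc m) \<le> L \<and>
        h (idx m) + len (idx m) (idx (Suc m)) + h (idx (Suc m)) \<le> 2 * H"
      unfolding idxS[OF that]
      by (rule GreatestI_nat[where k = "idx m" and b = L]) (use that H[OF that] len_self in auto)
    then show ?thesis by simp
  qed
  have idx_le: "idx m \<le> L" for m
    by (induction m) (use idx0 step in auto)
  have len_split: "len a i = len a j + len j i" if "a \<le> j" "j \<le> i" "i \<le> L" for a j i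
    using that(2,3,1)
  proof (induction i rule: dec_induct)
    case base
    then show ?case by (simp add: len_self)
  next
    case (step n)
    then show ?case by (simp add: len_Suc)
  qed
  have len_ge: "h j \<le> h a + len a j" if "a \<le> j" "j \<le> L" for a j
    using that
  proof (induction j rule: dec_induct)
    case base
    then show ?case by (simp add: len_self)
  next
    case (step n)
    then show ?case by (simp add: len_Suc)
  qed
  have max: "i \<le> idx (Suc m)"
    if a: "a \<le> i" "a \<le> idx m" "i \<le> L" "h a + len a i + h i \<le> 2 * H" for a i m
  proof (cases "i \<le> idx m")
    case True
    then show ?thesis using step[OF idx_le[of m]] by simp
  next
    case False
    have "h (idx m) + len (idx m) i + h i \<le> 2 * H"
      using len_split[of a "idx m" i] len_ge[of a "idx m"] a False by simp
    then show ?thesis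
      unfolding idxS[OF idx_le] by (intro Greatest_le_nat[where b = L]) (use False a in auto)
  qed
  \<comment> \<open>The witness \<open>a\<close> is where the current piece of the backlog process
    begins. The backlog is the total fall since \<open>a\<close>, so the length is the net rise plus
    twice the backlog.\<close>
  have inv: "(\<exists>a \<le> i. a \<le> idx (ncuts H h i) \<and> len a i = h i - h a + 2 * backlog H h i)
      \<and> i \<le> idx (Suc (ncuts H h i))" if "i \<le> L" for i
    using that
  proof (induction i)
    case 0
    then show ?case by (auto simp: len_self)
  next
    case (Suc i)
    then obtain a where a: "a \<le> i" "a \<le> idx (ncuts H h i)"
        "len a i = h i - h a + 2 * backlog H h i"
      and i: "i \<le> idx (Suc (ncuts H h i))" by auto
    have ex: "\<exists>a \<le> Suc i. a \<le> idx (ncuts H h (Suc i)) \<and>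
        len a (Suc i) = h (Suc i) - h a + 2 * backlog H h (Suc i)"
    proof (cases "is_cut H h i")
      case True
      \<comment> \<open>The new piece begins at \<open>i\<close>, not at \<open>Suc i\<close>,
        because it contains the rise that caused the cut.\<close>
      then have "len i (Suc i) = h (Suc i) - h i + 2 * backlog H h (Suc i)"
        using len_Suc[of i i] Suc.prems by (simp add: len_self backlog_Suc) (simp add: is_cut_def)
      then show ?thesis using i True by (intro exI[of _ i]) (auto simp: ncuts_Suc)
    next
      case False
      then have "len a (Suc i) = h (Suc i) - h a + 2 * backlog H h (Suc i)"
        using len_Suc[of a i] a Suc.prems by (auto simp: backlog_Suc abs_if max_def)
      then show ?thesis using a False by (intro exI[of _ a]) (auto simp: ncuts_Suc)
    qed
    then obtain a where a: "a \<le> Suc i" "a \<le> idx (ncuts H h (Suc i))"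
        "len a (Suc i) = h (Suc i) - h a + 2 * backlog H h (Suc i)" by auto
    have "h a + len a (Suc i) + h (Suc i) \<le> 2 * H"
      using a backlog_le[of L h H "Suc i"] H h0 Suc.prems by auto
    then have "Suc i \<le> idx (Suc (ncuts H h (Suc i)))"
      using max[of a "Suc i"] a Suc.prems by blast
    with ex show ?case by blast
  qed
  from inv[of L] have "L \<le> idx (Suc (ncuts H h L))" by simp
  with idx_le[of "Suc (ncuts H h L)"] show ?thesis by (intro exI[of _ "Suc (ncuts H h L)"]) auto
qed

section \<open>Laminar families\<close>

text \<open>Deleting a point \<open>x\<close> from the ground set merges or empties at most two
  members of the family, and the rest stays laminar.\<close>

lemma card_laminar_le:
  assumes "finite X" "X \<noteq> {}"
    and "\<And>A. A \<in> F \<Longrightarrow> A \<subseteq> X \<and> A \<noteq> {}"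
    and "\<And>A B. A \<in> F \<Longrightarrow> B \<in> F \<Longrightarrow> A \<subseteq> B \<or> B \<subseteq> A \<or> A \<inter> B = {}"
  shows "card F + 1 \<le> 2 * card X"
  using assms
proof (induction X arbitrary: F rule: finite_ne_induct)
  case (singleton x)
  have "F \<subseteq> {{x}}"
    using singleton.prems(1) by blast
  then have "card F \<le> 1" using card_mono[of "{{x}}" F] by simp
  then show ?case by simp
next
  case (insert x X)
  have "finite F" using insert.prems(1) insert.hyps by (intro finite_subset[of F "Pow (insert x X)"]) auto
  \<comment> \<open>\<open>F'\<close> drops \<open>{x}\<close>, which would become empty, and the
    sets that would collide with another member, so that deletion of \<open>x\<close> is injective
    on it.\<close>
  define F' where "F' = {A \<in> F. A \<noteq> {x} \<and> (x \<in> A \<longrightarrow> A - {x} \<notin> F)}"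
  have sub: "\<And>A. A \<in> F \<Longrightarrow> A \<subseteq> insert x X" and ne: "{} \<notin> F"
    using insert.prems(1) by auto
  have inj: "inj_on (\<lambda>A. A - {x}) F'"
  proof (rule inj_onI)
    fix A B assume "A \<in> F'" "B \<in> F'" "A - {x} = B - {x}"
    then show "A = B" by (cases "x \<in> A"; cases "x \<in> B") (auto simp: F'_def)
  qed
  have "card F' + 1 \<le> 2 * card X"
  proof -
    have "card ((\<lambda>A. A - {x}) ` F') + 1 \<le> 2 * card X"
    proof (rule insert.IH)
      show "A \<subseteq> X \<and> A \<noteq> {}" if "A \<in> (\<lambda>A. A - {x}) ` F'" for A
      proof -
        from that obtain A' where A': "A' \<in> F" "A' \<noteq> {x}" "A = A' - {x}" by (auto simp: F'_def)
        then have "A' \<noteq> {}" using ne by metis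
        then show ?thesis using A' sub[OF A'(1)] by blast
      qed
      fix A B assume "A \<in> (\<lambda>A. A - {x}) ` F'" "B \<in> (\<lambda>A. A - {x}) ` F'"
      then obtain A' B' where "A' \<in> F" "B' \<in> F" "A = A' - {x}" "B = B' - {x}"
        by (auto simp: F'_def)
      then show "A \<subseteq> B \<or> B \<subseteq> A \<or> A \<inter> B = {}" using insert.prems(2)[of A' B'] by blast
    qed
    then show ?thesis by (simp add: card_image[OF inj])
  qed
  moreover have "card (F - F') \<le> 2"
  proof -
    \<comment> \<open>Two such sets share \<open>x\<close>, hence are nested. If \<open>B\<close>
      were properly contained in \<open>A\<close>, then \<open>A - {x}\<close> and \<open>B\<close>
      would cross: they meet in \<open>B - {x}\<close>, and neither contains the other.\<close>
    have uniq: "A = B" if "A \<in> F" "B \<in> F" "x \<in> A" "x \<in> B" "A - {x} \<in> F" "B - {x} \<in> F" for A B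
    proof -
      have "A \<subseteq> B" if AB: "A \<in> F" "B \<in> F" "x \<in> A" "x \<in> B" "A - {x} \<in> F" "B - {x} \<in> F" for A B
      proof (rule ccontr)
        assume "\<not> A \<subseteq> B"
        then have "B \<subseteq> A" using insert.prems(2)[of A B] AB by blast
        moreover have "\<not> A - {x} \<subseteq> B" using \<open>\<not> A \<subseteq> B\<close> AB by blast
        moreover have "B - {x} \<noteq> {}" using AB ne by metis
        ultimately show False using insert.prems(2)[of "A - {x}" B] AB by blast
      qed
      then show ?thesis using that by blast
    qed
    define P where "P = {A \<in> F. x \<in> A \<and> A - {x} \<in> F}"
    have "card P \<le> Suc 0"
      using \<open>finite F\<close> uniq by (subst card_le_Suc0_iff_eq) (auto simp: P_def)
    moreover have "F - F' \<subseteq> insert {x} P" by (auto simp: F'_def P_def)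
    moreover have "finite P" using \<open>finite F\<close> by (simp add: P_def)
    ultimately show ?thesis
      using card_mono[of "insert {x} P" "F - F'"] card_insert_le_m1[of 2 P "{x}"] by simp
  qed
  moreover have "card F = card F' + card (F - F')"
    using \<open>finite F\<close> by (subst card_Un_disjoint[symmetric]) (auto simp: F'_def intro: arg_cong[of _ _ card])
  ultimately show ?case using insert.hyps by simp
qed

section \<open>Depth first search as a nested word\<close>

text \<open>
  \<open>U\<close> stands for the non-root vertices, identified with the edges to their parents, of weight \<open>l\<close>.
  Step \<open>d u\<close> of the traversal descends to \<open>u\<close> for the first time, and step \<open>f u\<close> finally leaves \<open>u\<close>
  for its parent. The ancestors of \<open>u\<close> are the vertices whose interval contains \<open>d u\<close>.

  \<open>Q j\<close> is the set of non-root vertices visited by the \<open>j\<close>-th route; a closed walk traverses each of the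
  corresponding edges at least twice, whence the bound \<open>H = B / 2\<close> on its weight.
\<close>

locale dfs_word =
  fixes U :: "'a set" and d f :: "'a \<Rightarrow> nat" and l :: "'a \<Rightarrow> real" and H :: real and L :: nat
    and Q :: "nat \<Rightarrow> 'a set" and K :: nat
  assumes fin_U [simp, intro]: "finite U"
    and d_inj: "inj_on d U" and f_inj: "inj_on f U"
    and df_disjoint: "d ` U \<inter> f ` U = {}" and df_steps: "d ` U \<union> f ` U = {..<L}"
    and d_less_f: "u \<in> U \<Longrightarrow> d u < f u"
    and nested: "u \<in> U \<Longrightarrow> v \<in> U \<Longrightarrow> d v < d u \<Longrightarrow> d u < f v \<Longrightarrow> f u < f v"
    and l_pos: "u \<in> U \<Longrightarrow> 0 < l u"
    and H_pos: "0 < H"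
    and depth_le': "u \<in> U \<Longrightarrow> (\<Sum>v\<in>{v \<in> U. d v \<le> d u \<and> d u < f v}. l v) \<le> H"
    and Q_sub: "j < K \<Longrightarrow> Q j \<subseteq> U"
    and Q_anc: "j < K \<Longrightarrow> u \<in> Q j \<Longrightarrow> v \<in> U \<Longrightarrow> d v \<le> d u \<Longrightarrow> d u < f v \<Longrightarrow> v \<in> Q j"
    and Q_weight: "j < K \<Longrightarrow> sum l (Q j) \<le> H"
    and Q_cover: "u \<in> U \<Longrightarrow> \<exists>j<K. u \<in> Q j"
    and K_pos: "0 < K"
begin

text \<open>The search stack at position \<open>t\<close>, without the root: step \<open>d u\<close>
  leads from position \<open>d u\<close> to the next one, hence the strict lower bound.\<close>

definition open_at :: "nat \<Rightarrow> 'a set" where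
  "open_at t = {u \<in> U. d u < t \<and> t \<le> f u}"

definition ht :: "nat \<Rightarrow> real" where
  "ht t = sum l (open_at t)"

definition anc :: "'a \<Rightarrow> 'a set" where
  "anc u = {v \<in> U. d v \<le> d u \<and> d u < f v}"

definition slack :: "'a \<Rightarrow> real" where
  "slack u = H - sum l (anc u)"

text \<open>The slack of the parent of \<open>u\<close>.\<close>

definition top_slack :: "'a \<Rightarrow> real" where
  "top_slack u = slack u + l u"

definition disc_weight :: "nat \<Rightarrow> nat \<Rightarrow> real" where
  "disc_weight i k = (\<Sum>u\<in>{u \<in> U. i \<le> d u \<and> d u < k}. l u)"

definition fin_weight :: "nat \<Rightarrow> nat \<Rightarrow> real" where
  "fin_weight i k = (\<Sum>u\<in>{u \<in> U. i \<le> f u \<and> f u < k}. l u)"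

section \<open>Ancestors, heights and slacks\<close>

lemma d_eq: "u \<in> U \<Longrightarrow> v \<in> U \<Longrightarrow> d u = d v \<longleftrightarrow> u = v"
  using d_inj by (auto dest: inj_onD)

lemma f_eq: "u \<in> U \<Longrightarrow> v \<in> U \<Longrightarrow> f u = f v \<longleftrightarrow> u = v"
  using f_inj by (auto dest: inj_onD)

lemma d_neq_f: "u \<in> U \<Longrightarrow> v \<in> U \<Longrightarrow> d u \<noteq> f v"
  using df_disjoint by auto

lemma d_less_L: "u \<in> U \<Longrightarrow> d u < L" and f_less_L: "u \<in> U \<Longrightarrow> f u < L"
  using df_steps by auto

lemma step_cases:
  assumes "t < L"
  obtains u where "u \<in> U" "t = d u" | u where "u \<in> U" "t = f u"
  using assms df_steps by (metis UnE imageE lessThan_iff)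

lemma anc_sub: "anc u \<subseteq> U"
  by (auto simp: anc_def)

lemma fin_anc [simp, intro]: "finite (anc u)"
  using anc_sub fin_U by (rule finite_subset)

lemma self_anc [simp, intro]: "u \<in> U \<Longrightarrow> u \<in> anc u"
  by (simp add: anc_def d_less_f)

lemma anc_D: "v \<in> anc u \<Longrightarrow> v \<in> U \<and> d v \<le> d u \<and> d u < f v"
  by (simp add: anc_def)

lemma anc_f_le: "u \<in> U \<Longrightarrow> v \<in> anc u \<Longrightarrow> f u \<le> f v"
  using nested[of u v] by (cases "u = v") (auto simp: anc_def d_eq less_le)

lemma anc_trans: "u \<in> U \<Longrightarrow> v \<in> anc u \<Longrightarrow> w \<in> anc v \<Longrightarrow> w \<in> anc u"
  using anc_f_le[of v w] by (auto simp: anc_def)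

lemma anc_antisym: "v \<in> anc u \<Longrightarrow> u \<in> anc v \<Longrightarrow> u = v"
  by (auto simp: anc_def d_eq[symmetric])

lemma anc_linear:
  assumes "v \<in> anc u" "w \<in> anc u"
  shows "v \<in> anc w \<or> w \<in> anc v"
  using assms by (auto simp: anc_def)

lemma open_at_Suc_d: "u \<in> U \<Longrightarrow> open_at (Suc (d u)) = anc u"
  by (auto simp: open_at_def anc_def)

lemma open_at_d: "u \<in> U \<Longrightarrow> open_at (d u) = anc u - {u}"
  using d_neq_f by (auto simp: open_at_def anc_def d_eq[symmetric] less_le)

text \<open>By nesting, whatever is opened after \<open>u\<close> is closed before \<open>u\<close>
  is left.\<close>

lemma open_at_f:
  assumes "u \<in> U"
  shows "open_at (f u) = anc u"
proof (intro equalityI subsetI)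
  fix v assume "v \<in> anc u"
  then show "v \<in> open_at (f u)"
    using anc_f_le[OF assms] d_less_f[OF assms] by (auto simp: open_at_def anc_def)
next
  fix v assume v: "v \<in> open_at (f u)"
  then have "\<not> d u < d v" using nested[of v u] assms by (auto simp: open_at_def)
  then show "v \<in> anc u" using v d_less_f[OF assms] by (auto simp: open_at_def anc_def)
qed

lemma open_at_Suc_f:
  assumes "u \<in> U"
  shows "open_at (Suc (f u)) = anc u - {u}"
proof -
  have "open_at (Suc (f u)) = open_at (f u) - {u}"
    using assms d_neq_f by (auto simp: open_at_def f_eq[symmetric] less_Suc_eq Suc_le_eq less_le)
  then show ?thesis using open_at_f[OF assms] by simp
qed

lemma ht_0 [simp]: "ht 0 = 0"
  by (simp add: ht_def open_at_def)

lemma ht_Suc_d: "u \<in> U \<Longrightarrow> ht (Suc (d u)) = H - slack u"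
  by (simp add: ht_def open_at_Suc_d slack_def)

lemma ht_f: "u \<in> U \<Longrightarrow> ht (f u) = H - slack u"
  by (simp add: ht_def open_at_f slack_def)

lemma sum_anc_minus: "u \<in> U \<Longrightarrow> sum l (anc u - {u}) = H - top_slack u"
  by (simp add: sum_diff1 top_slack_def slack_def)

lemma ht_d: "u \<in> U \<Longrightarrow> ht (d u) = H - top_slack u"
  by (simp add: ht_def open_at_d sum_anc_minus)

lemma ht_Suc_f: "u \<in> U \<Longrightarrow> ht (Suc (f u)) = H - top_slack u"
  by (simp add: ht_def open_at_Suc_f sum_anc_minus)

lemma slack_nonneg: "u \<in> U \<Longrightarrow> 0 \<le> slack u"
  using depth_le' by (simp add: slack_def anc_def)

lemma top_slack_pos: "u \<in> U \<Longrightarrow> 0 < top_slack u"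
  using slack_nonneg[of u] l_pos[of u] by (simp add: top_slack_def)

lemma slack_less_top: "u \<in> U \<Longrightarrow> slack u < top_slack u"
  using l_pos[of u] by (simp add: top_slack_def)

lemma ht_le: "t \<le> L \<Longrightarrow> ht t \<le> H"
proof (cases t)
  case (Suc s)
  assume "t \<le> L"
  with Suc have "s < L" by simp
  then show ?thesis
    by (cases rule: step_cases) (use Suc ht_Suc_d ht_Suc_f slack_nonneg top_slack_pos[THEN less_imp_le] in auto)
qed (use H_pos in simp)

text \<open>The ancestors form a chain, so the parent is the proper ancestor discovered last. The
  excluded case is that of a child of the root, which is not in \<open>U\<close>.\<close>

lemma parent_anc:
  assumes "u \<in> U" "anc u \<noteq> {u}"
  obtains p where "p \<in> U" "anc p = anc u - {u}"
proof -
  let ?A = "anc u - {u}"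
  have ne: "?A \<noteq> {}" using assms by auto
  obtain p where pU: "p \<in> ?A" and p: "d p = Max (d ` ?A)"
    using Max_in[of "d ` ?A"] ne by fastforce
  have max: "d w \<le> d p" if "w \<in> ?A" for w
    unfolding p using that by (intro Max_ge) auto
  have "d p < d u" using pU assms by (auto simp: anc_def d_eq[symmetric] less_le)
  have "anc p = ?A"
  proof (intro equalityI subsetI)
    fix w assume w: "w \<in> anc p"
    then have "f p \<le> f w" using anc_f_le pU by (auto simp: anc_def)
    then show "w \<in> ?A" using w pU \<open>d p < d u\<close> by (auto simp: anc_def)
  next
    fix w assume w: "w \<in> ?A"
    then show "w \<in> anc p" using max[OF w] \<open>d p < d u\<close> by (auto simp: anc_def)
  qed
  then show ?thesis using pU that anc_sub by blast
qed

text \<open>The \<open>top_slack\<close> of a vertex is the slack of its parent, so the terms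
  telescope up to the slack \<open>H\<close> of the root.\<close>

lemma telescope_anc:
  assumes "u \<in> U"
  shows "(\<Sum>v\<in>anc u - {u}. 1 / top_slack v - 1 / slack v) = 1 / H - 1 / top_slack u"
  using assms
proof (induction "card (anc u)" arbitrary: u rule: less_induct)
  case less
  show ?case
  proof (cases "anc u = {u}")
    case True
    then show ?thesis by (simp add: top_slack_def slack_def)
  next
    case False
    obtain p where p: "p \<in> U" "anc p = anc u - {u}"
      using parent_anc[OF less.prems False] .
    have "card (anc p) < card (anc u)"
      unfolding p using less.prems by (intro psubset_card_mono) auto
    then have IH: "(\<Sum>v\<in>anc p - {p}. 1 / top_slack v - 1 / slack v) = 1 / H - 1 / top_slack p"
      using less.hyps p by blast
    have "top_slack u = slack p"
      using sum_anc_minus[OF less.prems] p by (simp add: slack_def)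
    then show ?thesis
      using IH p(1) unfolding p(2)[symmetric] by (simp add: sum_diff1)
  qed
qed

section \<open>Weight discovered and finished in a time window\<close>

lemma disc_mono: "i \<le> i' \<Longrightarrow> k' \<le> k \<Longrightarrow> disc_weight i' k' \<le> disc_weight i k"
  unfolding disc_weight_def by (rule sum_mono2) (auto simp: l_pos less_imp_le)

lemma fin_mono: "i \<le> i' \<Longrightarrow> k' \<le> k \<Longrightarrow> fin_weight i' k' \<le> fin_weight i k"
  unfolding fin_weight_def by (rule sum_mono2) (auto simp: l_pos less_imp_le)

lemma disc_nonneg: "0 \<le> disc_weight i k"
  unfolding disc_weight_def by (rule sum_nonneg) (auto simp: l_pos less_imp_le)

lemma fin_add:
  assumes "i \<le> k" "k \<le> m"
  shows "fin_weight i m = fin_weight i k + fin_weight k m"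
  unfolding fin_weight_def using assms
  by (subst sum.union_disjoint[symmetric]) (auto intro!: sum.cong)

lemma disc_self [simp]: "disc_weight i i = 0" and fin_self [simp]: "fin_weight i i = 0"
  unfolding disc_weight_def fin_weight_def by (rule sum.neutral, simp)+

lemma disc_Suc_d: "u \<in> U \<Longrightarrow> i \<le> d u \<Longrightarrow> disc_weight i (Suc (d u)) = disc_weight i (d u) + l u"
proof -
  assume u: "u \<in> U" "i \<le> d u"
  have "{v \<in> U. i \<le> d v \<and> d v < Suc (d u)} = insert u {v \<in> U. i \<le> d v \<and> d v < d u}"
    using u by (auto simp: less_Suc_eq d_eq)
  then show ?thesis by (simp add: disc_weight_def)
qed

lemma disc_Suc_f: "u \<in> U \<Longrightarrow> disc_weight i (Suc (f u)) = disc_weight i (f u)"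
  unfolding disc_weight_def using d_neq_f by (intro sum.cong) (auto simp: less_Suc_eq)

lemma fin_Suc_f: "u \<in> U \<Longrightarrow> i \<le> f u \<Longrightarrow> fin_weight i (Suc (f u)) = fin_weight i (f u) + l u"
proof -
  assume u: "u \<in> U" "i \<le> f u"
  have "{v \<in> U. i \<le> f v \<and> f v < Suc (f u)} = insert u {v \<in> U. i \<le> f v \<and> f v < f u}"
    using u by (auto simp: less_Suc_eq f_eq)
  then show ?thesis by (simp add: fin_weight_def)
qed

lemma fin_Suc_d: "u \<in> U \<Longrightarrow> fin_weight i (Suc (d u)) = fin_weight i (d u)"
  unfolding fin_weight_def using d_neq_f by (intro sum.cong) (auto simp: less_Suc_eq, metis)

lemma ht_diff:
  assumes "i \<le> k" "k \<le> L"
  shows "ht k = ht i + disc_weight i k - fin_weight i k"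
  using assms
proof (induction k rule: dec_induct)
  case base
  then show ?case by simp
next
  case (step k)
  then have "k < L" by simp
  then show ?case
  proof (cases rule: step_cases)
    case (1 u)
    then have "ht (Suc k) = ht k + l u" by (simp add: ht_d ht_Suc_d top_slack_def)
    then show ?thesis using step 1 by (simp add: disc_Suc_d fin_Suc_d)
  next
    case (2 u)
    then have "ht (Suc k) = ht k - l u" by (simp add: ht_f ht_Suc_f top_slack_def)
    then show ?thesis using step 2 by (simp add: disc_Suc_f fin_Suc_f)
  qed
qed

section \<open>Cuts need discovered or finished weight\<close>

abbreviation bl :: "nat \<Rightarrow> real" where "bl \<equiv> backlog H ht"
abbreviation cut :: "nat \<Rightarrow> bool" where "cut \<equiv> is_cut H ht"
abbreviation pot :: "nat \<Rightarrow> real" where "pot \<equiv> cut_pot H ht"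

lemma bl_nonneg: "0 \<le> bl t"
  by (rule backlog_nonneg)

lemma bl_le: "t \<le> L \<Longrightarrow> bl t \<le> H - ht t"
  by (rule backlog_le[of L]) (auto simp: ht_le)

text \<open>Only finishing steps raise the backlog, each by the weight of its edge.\<close>

lemma bl_le_fin:
  assumes "i \<le> k" "k \<le> L"
  shows "bl k \<le> bl i + fin_weight i k"
  using assms
proof (induction k rule: dec_induct)
  case base
  then show ?case by simp
next
  case (step k)
  then have "k < L" by simp
  then show ?case
  proof (cases rule: step_cases)
    case (1 u)
    then have "bl (Suc k) \<le> bl k"
      using bl_nonneg[of k] by (auto simp: backlog_Suc ht_d ht_Suc_d top_slack_def dest: l_pos)
    then show ?thesis using step 1 by (simp add: fin_Suc_d)
  next
    case (2 u)
    then have "bl (Suc k) \<le> bl k + l u"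
      using bl_nonneg[of k] by (auto simp: backlog_Suc ht_f ht_Suc_f top_slack_def dest: l_pos)
    then show ?thesis using step 2 by (simp add: fin_Suc_f)
  qed
qed

lemma bl_after_cut:
  assumes "cut t" "t < k" "k \<le> L"
  shows "bl k \<le> fin_weight (Suc t) k"
  using bl_le_fin[of "Suc t" k] assms by (simp add: backlog_Suc)

text \<open>Finishing an edge moves its weight from the height to the backlog, so the sum of the two
  can grow past \<open>H\<close> only by weight discovered since \<open>a\<close>.\<close>

lemma cut_disc:
  assumes "cut t" "a \<le> t" "t < L"
  shows "H - ht a - bl a < disc_weight a (Suc t)"
proof -
  have "bl t \<le> bl a + fin_weight a t" using bl_le_fin[of a t] assms by simp
  moreover have "fin_weight a t \<le> fin_weight a (Suc t)" by (rule fin_mono) auto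
  moreover have "ht (Suc t) = ht a + disc_weight a (Suc t) - fin_weight a (Suc t)"
    using assms by (intro ht_diff) auto
  moreover have "H < bl t + ht (Suc t)" using assms by (simp add: is_cut_def)
  ultimately show ?thesis by simp
qed

text \<open>The first cut clears the backlog inherited from before \<open>a\<close>, so the term
  \<open>bl a\<close> of \<open>cut_disc\<close> disappears.\<close>

lemma two_cuts_disc:
  assumes "cut t" "cut t'" "a \<le> t" "t < t'" "t' < L"
  shows "H - ht a < disc_weight a (Suc t')"
proof -
  have "bl t' \<le> fin_weight (Suc t) t'" using bl_after_cut assms by simp
  also have "\<dots> \<le> fin_weight a (Suc t')" using assms by (intro fin_mono) auto
  finally have "bl t' \<le> fin_weight a (Suc t')" .
  moreover have "ht (Suc t') = ht a + disc_weight a (Suc t') - fin_weight a (Suc t')"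
    using assms by (intro ht_diff) auto
  moreover have "H < bl t' + ht (Suc t')" using assms by (simp add: is_cut_def)
  ultimately show ?thesis by simp
qed

text \<open>The backlog at the second cut was finished after the first one, and any height lost
  between the second cut and \<open>e\<close> is finished weight too.\<close>

lemma two_cuts_fin:
  assumes "cut t" "cut t'" "i \<le> t" "t < t'" "t' < e" "e \<le> L"
  shows "H - ht e < fin_weight i e"
proof -
  have "bl t' \<le> fin_weight (Suc t) t'" using bl_after_cut assms by simp
  also have "\<dots> \<le> fin_weight i (Suc t')" using assms by (intro fin_mono) auto
  finally have "bl t' \<le> fin_weight i (Suc t')" .
  moreover have "ht e = ht (Suc t') + disc_weight (Suc t') e - fin_weight (Suc t') e"
    using assms by (intro ht_diff) auto
  moreover have "fin_weight i e = fin_weight i (Suc t') + fin_weight (Suc t') e" using assms by (intro fin_add) auto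
  moreover have "H < bl t' + ht (Suc t')" using assms by (simp add: is_cut_def)
  ultimately show ?thesis using disc_nonneg[of "Suc t'" e] by simp
qed

section \<open>Increase of the potential at each step\<close>

definition gain :: "nat \<Rightarrow> real" where
  "gain t = pot (Suc t) - pot t"

lemma gain_nonneg: "t < L \<Longrightarrow> 0 \<le> gain t"
  unfolding gain_def using cut_pot_mono_Suc[of L ht H t] ht_le by simp

lemma gain_sum: "i \<le> k \<Longrightarrow> (\<Sum>t = i..<k. gain t) = pot k - pot i"
  unfolding gain_def by (rule sum_Suc_diff')

lemma ratio_bounds: "t \<le> L \<Longrightarrow> 0 \<le> bl t / (H - ht t) \<and> bl t / (H - ht t) \<le> 1"
  using backlog_ratio[of L ht H t] ht_le by simp

lemma gain_d:
  assumes "u \<in> U"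
  shows "gain (d u) = (if cut (d u) then 1 else bl (d u) / slack u) - bl (d u) / top_slack u"
  using l_pos[OF assms] assms
  by (auto simp: gain_def cut_pot_def ncuts_Suc ht_d ht_Suc_d backlog_Suc top_slack_def)

lemma cut_d_iff: "u \<in> U \<Longrightarrow> cut (d u) \<longleftrightarrow> slack u < bl (d u)"
  using l_pos[of u] by (auto simp: is_cut_def ht_d ht_Suc_d top_slack_def)

lemma not_cut_f: "u \<in> U \<Longrightarrow> \<not> cut (f u)"
  using l_pos[of u] by (auto simp: is_cut_def ht_f ht_Suc_f top_slack_def)

lemma bl_Suc_f: "u \<in> U \<Longrightarrow> bl (Suc (f u)) = bl (f u) + l u"
  using l_pos[of u] not_cut_f[of u] by (simp add: backlog_Suc ht_f ht_Suc_f top_slack_def)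

lemma gain_f:
  assumes "u \<in> U"
  shows "gain (f u) = (bl (f u) + l u) / top_slack u - bl (f u) / slack u"
  using assms by (simp add: gain_def cut_pot_def ncuts_Suc not_cut_f ht_f ht_Suc_f bl_Suc_f)

text \<open>At a cut the quotient \<open>bl (d u) / slack u\<close> exceeds 1, so it may replace the
  1 contributed by the cut.\<close>

lemma gain_d_le:
  assumes "u \<in> U" "0 < slack u"
  shows "gain (d u) \<le> bl (d u) * (1 / slack u - 1 / top_slack u)"
  using assms by (auto simp: gain_d cut_d_iff algebra_simps)

lemma gain_f_eq:
  assumes "u \<in> U" "0 < slack u"
  shows "gain (f u) = (slack u - bl (f u)) * (1 / slack u - 1 / top_slack u)"
  using assms top_slack_pos[OF assms(1)]
  by (simp add: gain_f divide_simps) (simp add: top_slack_def algebra_simps)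

text \<open>With zero slack the quotients by \<open>slack u\<close> are 0 by convention. At step
  \<open>f u\<close> the backlog vanishes and \<open>top_slack u = l u\<close>, which makes the gain
  exactly 1.\<close>

lemma gain_le_1:
  assumes "u \<in> U" "slack u = 0"
  shows "gain (d u) \<le> 1" "gain (f u) \<le> 1"
proof -
  have "0 \<le> bl (d u) / top_slack u" using top_slack_pos[OF assms(1)] bl_nonneg[of "d u"] by simp
  then show "gain (d u) \<le> 1" using assms by (auto simp: gain_d)
  have "bl (f u) = 0"
    using bl_le[of "f u"] f_less_L[of u] assms bl_nonneg[of "f u"] by (simp add: ht_f)
  then show "gain (f u) \<le> 1" using assms by (simp add: gain_f top_slack_def)
qed

text \<open>Every step belongs to exactly one vertex, so the gains telescope, and the initial
  potential is 0.\<close>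

lemma sum_gain: "(\<Sum>u\<in>U. gain (d u) + gain (f u)) = pot L"
proof -
  have "pot L = (\<Sum>t<L. gain t)"
    using gain_sum[of 0 L] by (simp add: cut_pot_def atLeast0LessThan)
  also have "\<dots> = sum gain (d ` U) + sum gain (f ` U)"
    unfolding df_steps[symmetric] using df_disjoint by (intro sum.union_disjoint) auto
  finally show ?thesis
    using d_inj f_inj by (simp add: sum.reindex sum.distrib)
qed

lemma ncuts_le_pot: "real (ncuts H ht L) \<le> pot L"
  using ratio_bounds[of L] by (simp add: cut_pot_def)

text \<open>Gains are nonnegative, so the steps of \<open>G\<close> may be extended to all steps
  from \<open>d v\<close> to \<open>d u\<close>. The final 1 covers either a cut at step
  \<open>d u\<close>, after which the backlog is 0, or else the last quotient.\<close>

lemma gain_sum_d_le: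
  assumes "v \<in> anc u" "u \<in> U" "finite G" "G \<subseteq> anc u" "\<And>w. w \<in> G \<Longrightarrow> v \<in> anc w"
  shows "(\<Sum>w\<in>G. gain (d w)) \<le> real (ncuts H ht (d u)) - real (ncuts H ht (d v)) + 1"
proof -
  have GU: "G \<subseteq> U" using assms anc_sub by blast
  have vu: "v \<in> U" "d v \<le> d u" using assms by (auto simp: anc_def)
  have "(\<Sum>w\<in>G. gain (d w)) = sum gain (d ` G)"
    using inj_on_subset[OF d_inj GU] by (simp add: sum.reindex)
  also have "\<dots> \<le> (\<Sum>t = d v..<Suc (d u). gain t)"
    using assms d_less_L[of u] by (intro sum_mono2) (auto simp: anc_def less_Suc_eq_le gain_nonneg)
  also have "\<dots> = pot (Suc (d u)) - pot (d v)" using vu by (intro gain_sum) simp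
  also have "\<dots> \<le> real (ncuts H ht (d u)) - real (ncuts H ht (d v)) + 1"
    using ratio_bounds[of "d v"] ratio_bounds[of "Suc (d u)"] d_less_L[of u] d_less_L[of v] assms vu
    by (auto simp: cut_pot_def ncuts_Suc backlog_Suc)
  finally show ?thesis .
qed

text \<open>The counterpart for the way up from \<open>f u\<close> to \<open>f v\<close>. Both end
  steps are finishing steps and hence no cuts, so the final 1 covers only the last quotient.\<close>

lemma gain_sum_f_le:
  assumes "v \<in> anc u" "u \<in> U" "finite G" "G \<subseteq> anc u" "\<And>w. w \<in> G \<Longrightarrow> v \<in> anc w"
  shows "(\<Sum>w\<in>G. gain (f w)) \<le> real (ncuts H ht (f v)) - real (ncuts H ht (Suc (f u))) + 1"
proof -
  have GU: "G \<subseteq> U" using assms anc_sub by blast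
  have vu: "v \<in> U" "f u \<le> f v" using assms anc_sub anc_f_le by auto
  have "(\<Sum>w\<in>G. gain (f w)) = sum gain (f ` G)"
    using inj_on_subset[OF f_inj GU] by (simp add: sum.reindex)
  also have "\<dots> \<le> (\<Sum>t = f u..<Suc (f v). gain t)"
    using assms GU f_less_L[of v] vu anc_f_le
    by (intro sum_mono2) (auto simp: less_Suc_eq_le gain_nonneg subset_iff)
  also have "\<dots> = pot (Suc (f v)) - pot (f u)" using vu by (intro gain_sum) simp
  also have "\<dots> \<le> real (ncuts H ht (f v)) - real (ncuts H ht (Suc (f u))) + 1"
    using ratio_bounds[of "f u"] ratio_bounds[of "Suc (f v)"] f_less_L[of u] f_less_L[of v] assms vu
    by (auto simp: cut_pot_def ncuts_Suc not_cut_f)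
  finally show ?thesis .
qed

section \<open>Comparison with an arbitrary strategy\<close>

definition below :: "nat \<Rightarrow> 'a \<Rightarrow> 'a set" where
  "below j u = {v \<in> Q j. u \<in> anc v \<and> v \<noteq> u}"

definition W :: "nat \<Rightarrow> 'a \<Rightarrow> real" where
  "W j u = sum l (below j u)"

definition J :: "'a \<Rightarrow> nat set" where
  "J u = {j. j < K \<and> u \<in> Q j}"

text \<open>
  The increase, along the edge above \<open>u\<close>, of the weight that route \<open>j\<close> covers below a vertex divided by
  the slack of that vertex. If \<open>slack u = 0\<close>, then \<open>W j u = 0\<close> and the second quotient is the junk value
  \<open>0 / 0 = 0\<close>, which makes the increase \<open>1\<close>.
\<close>

definition cost :: "nat \<Rightarrow> 'a \<Rightarrow> real" where
  "cost j u = (W j u + l u) / top_slack u - W j u / slack u"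

text \<open>For one route, the summand is the budget left after the path from the root to
  \<open>u\<close> and everything it visits below \<open>u\<close>. The sum therefore limits what
  the visitors of \<open>u\<close> can explore elsewhere.\<close>

definition spare :: "'a \<Rightarrow> real" where
  "spare u = (\<Sum>j\<in>J u. slack u - W j u)"

definition bad :: "'a set" where
  "bad = {u \<in> U. 4 * (\<Sum>j\<in>J u. cost j u) < gain (d u) + gain (f u)}"

lemma fin_Q [simp]: "j < K \<Longrightarrow> finite (Q j)"
  using Q_sub fin_U by (rule finite_subset)

lemma fin_J [simp]: "finite (J u)"
  by (simp add: J_def)

lemma J_ne: "u \<in> U \<Longrightarrow> J u \<noteq> {}"
  using Q_cover by (auto simp: J_def)

lemma anc_sub_Q: "j < K \<Longrightarrow> u \<in> Q j \<Longrightarrow> anc u \<subseteq> Q j"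
  using Q_anc by (auto simp: anc_def)

lemma J_mono: "v \<in> anc u \<Longrightarrow> J u \<subseteq> J v"
  using anc_sub_Q by (auto simp: J_def)

lemma below_fin [simp]: "j < K \<Longrightarrow> finite (below j u)"
  by (simp add: below_def)

lemma W_nonneg: "j < K \<Longrightarrow> 0 \<le> W j u"
  unfolding W_def using Q_sub by (intro sum_nonneg) (auto simp: below_def l_pos less_imp_le subset_iff)

lemma sum_Q_mono: "j < K \<Longrightarrow> A \<subseteq> Q j \<Longrightarrow> sum l A \<le> H"
proof -
  assume j: "j < K" "A \<subseteq> Q j"
  have "sum l A \<le> sum l (Q j)"
    using j Q_sub[of j] by (intro sum_mono2) (auto simp: l_pos less_imp_le subset_iff)
  then show ?thesis using Q_weight[OF j(1)] by simp
qed

lemma anc_below_disjoint: "anc u \<inter> below j u = {}"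
  using anc_antisym by (auto simp: below_def)

lemma W_le:
  assumes "j \<in> J u"
  shows "W j u \<le> slack u"
proof -
  have j: "j < K" "u \<in> Q j" using assms by (auto simp: J_def)
  have "sum l (anc u \<union> below j u) \<le> H"
    using anc_sub_Q[OF j] by (intro sum_Q_mono[OF j(1)]) (auto simp: below_def)
  then show ?thesis
    using anc_below_disjoint[of u j] j by (simp add: sum.union_disjoint W_def slack_def)
qed

lemma cost_eq:
  assumes "u \<in> U" "0 < slack u"
  shows "cost j u = (slack u - W j u) * (1 / slack u - 1 / top_slack u)"
  using assms top_slack_pos[OF assms(1)]
  by (simp add: cost_def divide_simps) (simp add: top_slack_def algebra_simps)

lemma cost_sum_eq:
  assumes "u \<in> U" "0 < slack u"
  shows "(\<Sum>j\<in>J u. cost j u) = spare u * (1 / slack u - 1 / top_slack u)"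
  by (simp add: spare_def cost_eq[OF assms] sum_distrib_right)

lemma cost_tight:
  assumes "u \<in> U" "slack u = 0" "j \<in> J u"
  shows "1 \<le> cost j u"
  using top_slack_pos[OF assms(1)] assms W_nonneg[of j u]
  by (auto simp: cost_def top_slack_def J_def divide_simps)

lemma spare_nonneg: "0 \<le> spare u"
  unfolding spare_def using W_le by (intro sum_nonneg) (auto simp: J_def)

lemma spare_ge: "j \<in> J u \<Longrightarrow> slack u - W j u \<le> spare u"
  unfolding spare_def using W_le by (intro member_le_sum) auto

text \<open>Exchanging the order of summation, the terms telescope along each path to the root.\<close>

lemma cost_total:
  assumes "j < K"
  shows "(\<Sum>u\<in>Q j. cost j u) \<le> 1"
proof -
  define g where "g u = 1 / top_slack u - 1 / slack u" for u
  have "(\<Sum>u\<in>Q j. cost j u) = (\<Sum>u\<in>Q j. W j u * g u) + (\<Sum>u\<in>Q j. l u / top_slack u)"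
    unfolding sum.distrib[symmetric] by (rule sum.cong) (auto simp: cost_def g_def algebra_simps add_divide_distrib)
  also have "(\<Sum>u\<in>Q j. W j u * g u) = (\<Sum>u\<in>Q j. \<Sum>v\<in>{v \<in> Q j. u \<in> anc v \<and> v \<noteq> u}. l v * g u)"
    by (simp add: W_def below_def sum_distrib_right)
  also have "\<dots> = (\<Sum>v\<in>Q j. \<Sum>u\<in>{u \<in> Q j. u \<in> anc v \<and> v \<noteq> u}. l v * g u)"
    using assms by (intro sum.swap_restrict) auto
  also have "\<dots> = (\<Sum>v\<in>Q j. l v * (1 / H - 1 / top_slack v))"
  proof (rule sum.cong)
    fix v assume v: "v \<in> Q j"
    have "{u \<in> Q j. u \<in> anc v \<and> v \<noteq> u} = anc v - {v}"
      using anc_sub_Q[OF assms v] by auto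
    then show "(\<Sum>u\<in>{u \<in> Q j. u \<in> anc v \<and> v \<noteq> u}. l v * g u) = l v * (1 / H - 1 / top_slack v)"
      using telescope_anc[of v] Q_sub[OF assms] v by (auto simp: g_def sum_distrib_left[symmetric])
  qed simp
  also have "\<dots> + (\<Sum>u\<in>Q j. l u / top_slack u) = (\<Sum>v\<in>Q j. l v / H)"
    unfolding sum.distrib[symmetric] by (rule sum.cong) (auto simp: algebra_simps)
  also have "\<dots> \<le> 1" using Q_weight[OF assms] H_pos by (simp add: sum_divide_distrib[symmetric])
  finally show ?thesis .
qed

lemma cost_total_all: "(\<Sum>u\<in>U. \<Sum>j\<in>J u. cost j u) \<le> K"
proof -
  have "(\<Sum>u\<in>U. \<Sum>j\<in>J u. cost j u) = (\<Sum>u\<in>U. \<Sum>j\<in>{j \<in> {..<K}. u \<in> Q j}. cost j u)"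
    by (simp add: J_def)
  also have "\<dots> = (\<Sum>j<K. \<Sum>u\<in>{u \<in> U. u \<in> Q j}. cost j u)"
    by (intro sum.swap_restrict) auto
  also have "\<dots> = (\<Sum>j<K. \<Sum>u\<in>Q j. cost j u)"
    using Q_sub by (intro sum.cong) auto
  also have "\<dots> \<le> (\<Sum>j<K. 1)" using cost_total by (intro sum_mono) auto
  finally show ?thesis by simp
qed

lemma cost_nonneg: "u \<in> U \<Longrightarrow> j \<in> J u \<Longrightarrow> 0 \<le> cost j u"
proof -
  assume u: "u \<in> U" "j \<in> J u"
  show ?thesis
  proof (cases "slack u = 0")
    case True
    then show ?thesis using cost_tight[OF u(1) True u(2)] by simp
  next
    case False
    then have "0 < slack u" using slack_nonneg[OF u(1)] by simp
    then show ?thesis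
      using W_le[OF u(2)] slack_less_top[OF u(1)] by (simp add: cost_eq u frac_le)
  qed
qed

text \<open>With zero slack the two gains add up to at most 2, whereas a single visiting route
  already has cost at least 1, which counts four times.\<close>

lemma bad_slack:
  assumes "u \<in> bad"
  shows "0 < slack u"
proof (rule ccontr)
  assume "\<not> 0 < slack u"
  have u: "u \<in> U" using assms by (simp add: bad_def)
  then have s: "slack u = 0" using slack_nonneg[of u] \<open>\<not> 0 < slack u\<close> by simp
  obtain j where j: "j \<in> J u" using J_ne[OF u] by auto
  have "1 \<le> cost j u" using cost_tight[OF u s j] .
  also have "\<dots> \<le> (\<Sum>j\<in>J u. cost j u)"
    using cost_nonneg[OF u] j by (intro member_le_sum) auto
  finally show False using gain_le_1[OF u s] assms by (simp add: bad_def)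
qed

text \<open>For positive slack, the bounds on the gains and the total cost are multiples of the same
  positive number \<open>1 / slack u - 1 / top_slack u\<close>, which cancels.\<close>

lemma bad_spare:
  assumes "u \<in> bad"
  shows "4 * spare u < bl (d u) + (slack u - bl (f u))"
proof -
  have u: "u \<in> U" using assms by (simp add: bad_def)
  define c where "c = 1 / slack u - 1 / top_slack u"
  have c: "0 < c"
    using bad_slack[OF assms] slack_less_top[OF u] by (simp add: c_def frac_less2)
  have "4 * (spare u * c) < bl (d u) * c + (slack u - bl (f u)) * c"
    using assms cost_sum_eq[OF u bad_slack[OF assms]] gain_d_le[OF u bad_slack[OF assms]]
      gain_f_eq[OF u bad_slack[OF assms]]
    by (simp add: bad_def c_def)
  then have "(4 * spare u) * c < (bl (d u) + (slack u - bl (f u))) * c" by (simp add: algebra_simps)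
  then show ?thesis using c by (simp only: mult_less_cancel_right_pos)
qed

lemma bl_bounds:
  assumes "u \<in> U"
  shows "bl (d u) \<le> top_slack u" "bl (f u) \<le> slack u"
  using bl_le[of "d u"] bl_le[of "f u"] d_less_L[OF assms] f_less_L[OF assms] assms
  by (auto simp: ht_d ht_f)

text \<open>The right-hand side of \<open>bad_spare\<close> is at most
  \<open>top_slack u + slack u\<close>, which is less than \<open>2 * top_slack u\<close>.\<close>

lemma bad_spare_less:
  assumes "u \<in> bad"
  shows "2 * spare u < top_slack u"
  using bad_spare[OF assms] bl_bounds[of u] bl_nonneg[of "f u"] slack_less_top[of u] assms
  by (simp add: bad_def)

text \<open>
  At a bad vertex each visiting route spends more than half of the parent's slack at or below it, which
  is impossible at two incomparable vertices.
\<close>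

lemma bad_laminar:
  assumes u: "u \<in> bad" and v: "v \<in> bad" and "u \<notin> anc v" "v \<notin> anc u"
  shows "J u \<inter> J v = {}"
proof (rule ccontr)
  assume "J u \<inter> J v \<noteq> {}"
  then obtain j where j: "j \<in> J u" "j \<in> J v" by auto
  then have jK: "j < K" and Q: "u \<in> Q j" "v \<in> Q j" by (auto simp: J_def)
  \<comment> \<open>A common route spends more than half of each \<open>top_slack\<close> at or
    below the respective vertex, and both amounts together fit into \<open>top_slack u\<close>. The
    roles of \<open>u\<close> and \<open>v\<close> are symmetric, which yields the
    contradiction.\<close>
  have less: "top_slack v < top_slack u"
    if uv: "u \<in> bad" "v \<in> bad" "u \<notin> anc v" "v \<notin> anc u" "j \<in> J u" "j \<in> J v" for u v
  proof -
    have U: "u \<in> U" "v \<in> U" using uv by (auto simp: bad_def)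
    have Q: "u \<in> Q j" "v \<in> Q j" using uv by (auto simp: J_def)
    let ?A = "anc u - {u}" and ?B = "insert u (below j u)" and ?C = "insert v (below j v)"
    have "sum l (?A \<union> (?B \<union> ?C)) \<le> H"
      using anc_sub_Q[OF jK] Q by (intro sum_Q_mono[OF jK]) (auto simp: below_def)
    moreover have "?A \<inter> (?B \<union> ?C) = {}"
      using anc_antisym[of _ u] anc_trans[OF U(1)] uv(3,4) by (auto simp: below_def)
    moreover have "?B \<inter> ?C = {}"
      using anc_linear[of u _ v] uv(3,4) U by (auto simp: below_def)
    moreover have "sum l ?B = W j u + l u" "sum l ?C = W j v + l v"
      using jK by (simp_all add: W_def below_def)
    ultimately have "sum l ?A + (W j u + l u + (W j v + l v)) \<le> H"
      using jK by (simp add: sum.union_disjoint del: insert_iff Un_insert_left Un_insert_right sum.insert)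
    then have "W j u + l u + (W j v + l v) \<le> top_slack u"
      using sum_anc_minus[OF U(1)] by simp
    moreover have "slack u - W j u \<le> spare u" "slack v - W j v \<le> spare v"
      using spare_ge uv by auto
    ultimately show ?thesis
      using bad_spare_less[OF uv(1)] bad_spare_less[OF uv(2)] top_slack_def[of u] top_slack_def[of v]
      by linarith
  qed
  show False using less[of u v] less[of v u] assms j by simp
qed

text \<open>A route visiting some \<open>x\<close> in \<open>M\<close> also visits its ancestor
  \<open>v\<close>, and hence \<open>u\<close> because the visitors agree. What it visits in
  \<open>M\<close> must then fit into the budget left beside the ancestors of \<open>u\<close> and
  the vertices below \<open>u\<close>.\<close>

lemma between_weight:
  assumes "v \<in> anc u" "u \<in> U" "J v = J u"
    and M: "M \<subseteq> U" "\<And>x. x \<in> M \<Longrightarrow> v \<in> anc x \<and> u \<notin> anc x \<and> x \<notin> anc u"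
  shows "sum l M \<le> spare u"
proof -
  have finM: "finite M" using M(1) fin_U by (rule finite_subset)
  have "sum l M \<le> (\<Sum>x\<in>M. \<Sum>j\<in>J u. if x \<in> Q j then l x else 0)"
  proof (rule sum_mono)
    fix x assume x: "x \<in> M"
    then obtain j where "j \<in> J x" using J_ne M by blast
    then have j: "j \<in> J u" "x \<in> Q j"
      using J_mono[of v x] M(2)[OF x] assms(3) by (auto simp: J_def)
    have "(if x \<in> Q j then l x else 0) \<le> (\<Sum>j\<in>J u. if x \<in> Q j then l x else 0)"
      using j x M(1) by (intro member_le_sum) (auto simp: l_pos less_imp_le)
    then show "l x \<le> (\<Sum>j\<in>J u. if x \<in> Q j then l x else 0)" using j by simp
  qed
  also have "\<dots> = (\<Sum>j\<in>J u. sum l (M \<inter> Q j))"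
    using finM by (subst sum.swap) (simp add: sum.inter_restrict)
  also have "\<dots> \<le> spare u"
    unfolding spare_def
  proof (rule sum_mono)
    fix j assume "j \<in> J u"
    then have j: "j < K" "u \<in> Q j" by (auto simp: J_def)
    have "sum l (anc u \<union> (below j u \<union> (M \<inter> Q j))) \<le> H"
      using anc_sub_Q[OF j] by (intro sum_Q_mono[OF j(1)]) (auto simp: below_def)
    moreover have "anc u \<inter> (below j u \<union> (M \<inter> Q j)) = {}"
      using anc_below_disjoint[of u j] M by auto
    moreover have "below j u \<inter> (M \<inter> Q j) = {}" using M by (auto simp: below_def)
    ultimately show "sum l (M \<inter> Q j) \<le> slack u - W j u"
      using j by (simp add: sum.union_disjoint W_def slack_def)
  qed
  finally show ?thesis .
qed

text \<open>A vertex finished between \<open>d v\<close> and \<open>d u\<close>, or discovered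
  between \<open>f u\<close> and \<open>f v\<close>, lies in a side branch: below \<open>v\<close>
  but incomparable to \<open>u\<close>.\<close>

lemma window_weights:
  assumes "v \<in> anc u" "u \<in> U" "J v = J u"
  shows "fin_weight (d v) (d u) \<le> spare u" "disc_weight (Suc (f u)) (f v) \<le> spare u"
proof -
  have v: "v \<in> U" "d v \<le> d u" "f u \<le> f v" "d u < f u" "d v < f v"
    using assms anc_f_le d_less_f by (auto simp: anc_def)
  show "fin_weight (d v) (d u) \<le> spare u"
    unfolding fin_weight_def
  proof (rule between_weight[OF assms])
    fix x assume "x \<in> {u' \<in> U. d v \<le> f u' \<and> f u' < d u}"
    then have x: "x \<in> U" "d v \<le> f x" "f x < d u" by auto
    have "d v < f x" using x v d_neq_f[of v x] by simp
    have "\<not> d x < d v" using nested[of v x] x v \<open>d v < f x\<close> by auto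
    then show "v \<in> anc x \<and> u \<notin> anc x \<and> x \<notin> anc u"
      using x v d_less_f[of x] by (auto simp: anc_def)
  qed auto
  show "disc_weight (Suc (f u)) (f v) \<le> spare u"
    unfolding disc_weight_def
    by (rule between_weight[OF assms]) (use v in \<open>auto simp: anc_def\<close>)
qed

text \<open>
  Bad vertices with the same visitors form a chain with lowest element \<open>u\<close> and highest element \<open>v\<close>.
  Their gains are collected in the two time windows in which the search goes down from \<open>v\<close> to \<open>u\<close> and up
  from \<open>u\<close> to \<open>v\<close>, and the potential increases in a window by at most one plus the number of cuts. The
  side branches explored in each window weigh at most \<open>spare u\<close>, which is too little for two cuts; and
  badness of \<open>u\<close> makes it too little even for one cut in one of the windows.
\<close>

lemma group_gain:
  assumes G: "G \<subseteq> bad" "G \<noteq> {}" and J: "\<And>x. x \<in> G \<Longrightarrow> J x = A"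
  shows "(\<Sum>x\<in>G. gain (d x) + gain (f x)) \<le> 3"
proof -
  have GU: "G \<subseteq> U" using G by (auto simp: bad_def)
  have finG: "finite G" using GU fin_U by (rule finite_subset)
  \<comment> \<open>Incomparable members would have disjoint sets of visitors, but these are equal
    and nonempty.\<close>
  have chain: "x \<in> anc y \<or> y \<in> anc x" if "x \<in> G" "y \<in> G" for x y
    using bad_laminar[of x y] that G J J_ne GU by (metis inf.idem subsetD)
  obtain u where u: "u \<in> G" "d u = Max (d ` G)" using Max_in[of "d ` G"] G finG by fastforce
  obtain v where v: "v \<in> G" "d v = Min (d ` G)" using Min_in[of "d ` G"] G finG by fastforce
  have below_u: "x \<in> anc u" if "x \<in> G" for x
  proof -
    have "d x \<le> d u" unfolding u using that finG by auto
    then show ?thesis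
      using chain[OF that u(1)] d_eq[of u x] d_less_f[of x] that u(1) GU by (auto simp: anc_def)
  qed
  have above_v: "v \<in> anc x" if "x \<in> G" for x
  proof -
    have "d v \<le> d x" unfolding v using that finG by auto
    then show ?thesis
      using chain[OF that v(1)] anc_D[of x v] d_eq[of v x] self_anc[of v] that v(1) GU by force
  qed
  have uU: "u \<in> U" and vU: "v \<in> U" and vu: "v \<in> anc u" and ubad: "u \<in> bad"
    using u v GU G below_u by auto
  have Jvu: "J v = J u" using u v J by simp
  note ww = window_weights[OF vu uU Jvu]
  have sp: "spare u < top_slack u" using bad_spare_less[OF ubad] spare_nonneg[of u] by simp
  have L: "d u < L" "f v < L" "f u < L" using d_less_L f_less_L uU vU by auto
  have ord: "d v \<le> d u" "f u \<le> f v" using vu anc_f_le uU by (auto simp: anc_def)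
  have down: "ncuts H ht (d u) \<le> ncuts H ht (d v) + 1"
  proof (rule ncuts_one_cut)
    fix t t' assume t: "d v \<le> t" "t < t'" "t' < d u" "cut t" "cut t'"
    have "H - ht (d u) < fin_weight (d v) (d u)" using two_cuts_fin[of t t' "d v" "d u"] t L by simp
    then show False using ww sp by (simp add: ht_d uU)
  qed (use ord in simp)
  have up: "ncuts H ht (f v) \<le> ncuts H ht (Suc (f u)) + 1" if "f u \<noteq> f v"
  proof (rule ncuts_one_cut)
    fix t t' assume t: "Suc (f u) \<le> t" "t < t'" "t' < f v" "cut t" "cut t'"
    have "H - ht (Suc (f u)) < disc_weight (Suc (f u)) (Suc t')"
      using two_cuts_disc[of t t' "Suc (f u)"] t L by simp
    also have "\<dots> \<le> disc_weight (Suc (f u)) (f v)" using t by (intro disc_mono) auto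
    finally show False using ww sp by (simp add: ht_Suc_f uU)
  qed (use ord that in simp)
  \<comment> \<open>If \<open>f u = f v\<close>, the window is empty and its end \<open>f v\<close>
    precedes its start \<open>Suc (f u)\<close>.\<close>
  have up': "ncuts H ht (f v) \<le> ncuts H ht (Suc (f u)) + 1"
    using up by (cases "f u = f v") (auto simp: ncuts_Suc)
  have "real (ncuts H ht (d u)) - real (ncuts H ht (d v)) +
      (real (ncuts H ht (f v)) - real (ncuts H ht (Suc (f u)))) \<le> 1"
  proof (cases "spare u < bl (d u)")
    \<comment> \<open>A cut on the way down would leave a backlog consisting only of side branches,
      too small for \<open>bl (d u)\<close>.\<close>
    case True
    have "ncuts H ht (d u) = ncuts H ht (d v)"
    proof (rule ncuts_no_cut)
      fix t assume t: "d v \<le> t" "t < d u"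
      show "\<not> cut t"
      proof
        assume "cut t"
        then have "bl (d u) \<le> fin_weight (Suc t) (d u)" using bl_after_cut t L by simp
        also have "\<dots> \<le> fin_weight (d v) (d u)" using t by (intro fin_mono) auto
        finally show False using ww True by simp
      qed
    qed (use ord in simp)
    then show ?thesis using up' by simp
  next
    case False
    then have sf: "spare u \<le> slack u - bl (f u)" using bad_spare[OF ubad] spare_nonneg[of u] by simp
    have "ncuts H ht (f v) \<le> ncuts H ht (Suc (f u))"
    proof (cases "f u = f v")
      case True
      then show ?thesis by (simp add: ncuts_Suc)
    next
      case F: False
      have "ncuts H ht (f v) = ncuts H ht (Suc (f u))"
      proof (rule ncuts_no_cut)
        fix t assume t: "Suc (f u) \<le> t" "t < f v"
        show "\<not> cut t"
        proof
          assume "cut t"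
          then have "H - ht (Suc (f u)) - bl (Suc (f u)) < disc_weight (Suc (f u)) (Suc t)"
            using cut_disc t L by simp
          also have "\<dots> \<le> disc_weight (Suc (f u)) (f v)" using t by (intro disc_mono) auto
          finally show False
            using ww sf by (simp add: ht_Suc_f bl_Suc_f uU top_slack_def)
        qed
      qed (use F ord in simp)
      then show ?thesis by simp
    qed
    then show ?thesis using down by simp
  qed
  moreover have "(\<Sum>x\<in>G. gain (d x)) \<le> real (ncuts H ht (d u)) - real (ncuts H ht (d v)) + 1"
    using below_u above_v by (intro gain_sum_d_le[OF vu uU finG]) auto
  moreover have "(\<Sum>x\<in>G. gain (f x)) \<le> real (ncuts H ht (f v)) - real (ncuts H ht (Suc (f u))) + 1"
    using below_u above_v by (intro gain_sum_f_le[OF vu uU finG]) auto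
  ultimately show ?thesis by (simp add: sum.distrib)
qed

lemma ncuts_bound: "ncuts H ht L + 1 \<le> 10 * K"
proof -
  have finbad: "finite bad" by (simp add: bad_def)
  have badU: "bad \<subseteq> U" by (auto simp: bad_def)
  have "real (ncuts H ht L) \<le> (\<Sum>u\<in>U. gain (d u) + gain (f u))"
    using ncuts_le_pot sum_gain by simp
  also have "\<dots> = (\<Sum>u\<in>U - bad. gain (d u) + gain (f u)) + (\<Sum>u\<in>bad. gain (d u) + gain (f u))"
    using badU by (intro sum.subset_diff) auto
  also have "(\<Sum>u\<in>U - bad. gain (d u) + gain (f u)) \<le> (\<Sum>u\<in>U - bad. 4 * (\<Sum>j\<in>J u. cost j u))"
    by (intro sum_mono) (auto simp: bad_def)
  also have "\<dots> \<le> (\<Sum>u\<in>U. 4 * (\<Sum>j\<in>J u. cost j u))"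
    by (intro sum_mono2) (auto intro!: sum_nonneg cost_nonneg)
  also have "\<dots> \<le> 4 * real K"
    using cost_total_all by (simp add: sum_distrib_left[symmetric])
  also have "(\<Sum>u\<in>bad. gain (d u) + gain (f u)) =
      (\<Sum>A\<in>J ` bad. \<Sum>u\<in>{u \<in> bad. J u = A}. gain (d u) + gain (f u))"
    by (rule sum.image_gen[OF finbad])
  also have "\<dots> \<le> (\<Sum>A\<in>J ` bad. 3)"
    by (intro sum_mono group_gain) auto
  finally have "real (ncuts H ht L) \<le> 4 * real K + 3 * real (card (J ` bad))" by simp
  moreover have "card (J ` bad) + 1 \<le> 2 * card {..<K}"
  proof (rule card_laminar_le)
    show "A \<subseteq> {..<K} \<and> A \<noteq> {}" if "A \<in> J ` bad" for A
      using that J_ne badU by (auto simp: J_def)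
    fix A B assume "A \<in> J ` bad" "B \<in> J ` bad"
    \<comment> \<open>Comparable vertices have nested sets of visitors, incomparable bad ones
      disjoint sets.\<close>
    then show "A \<subseteq> B \<or> B \<subseteq> A \<or> A \<inter> B = {}"
      using bad_laminar J_mono by blast
  qed (use K_pos in auto)
  ultimately show ?thesis by simp
qed

end

section \<open>The stack of a depth first search\<close>

text \<open>The full history of stacks, of which \<open>dfs_state\<close> keeps only the last one;
  it allows steps to be assigned to vertices. The two alternatives are a push and a pop.\<close>

definition stack_run :: "'a set set \<Rightarrow> 'a \<Rightarrow> nat \<Rightarrow> (nat \<Rightarrow> 'a) \<Rightarrow> (nat \<Rightarrow> 'a list) \<Rightarrow> bool" where
  "stack_run E r L v S \<longleftrightarrow> S 0 = [r] \<and> (\<forall>i\<le>L. S i \<noteq> [] \<and> hd (S i) = v i) \<and>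
    (\<forall>i<L.
      S (Suc i) = v (Suc i) # S i \<and> {v i, v (Suc i)} \<in> E \<and> v (Suc i) \<notin> v ` {..i} \<or>
      S i = v i # S (Suc i) \<and> (\<forall>u. {v i, u} \<in> E \<longrightarrow> u \<in> v ` {..i}))"

lemma stack_run_extend:
  assumes run: "stack_run E r L v S" and "st \<noteq> []"
    and new: "st = hd st # S L \<and> {v L, hd st} \<in> E \<and> hd st \<notin> v ` {..L} \<or>
      S L = v L # st \<and> (\<forall>u. {v L, u} \<in> E \<longrightarrow> u \<in> v ` {..L})"
    and v': "\<And>i. i \<le> L \<Longrightarrow> v' i = v i" "v' (Suc L) = hd st"
  shows "stack_run E r (Suc L) v' (S(Suc L := st))"
proof -
  have im: "v' ` {..i} = v ` {..i}" if "i \<le> L" for i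
    using that v' by (intro image_cong) auto
  show ?thesis
    unfolding stack_run_def
  proof (intro conjI allI impI)
    fix i assume "i < Suc L"
    then consider "i < L" | "i = L" by linarith
    then show "(S(Suc L := st)) (Suc i) = v' (Suc i) # (S(Suc L := st)) i \<and> {v' i, v' (Suc i)} \<in> E \<and> v' (Suc i) \<notin> v' ` {..i} \<or>
      (S(Suc L := st)) i = v' i # (S(Suc L := st)) (Suc i) \<and> (\<forall>u. {v' i, u} \<in> E \<longrightarrow> u \<in> v' ` {..i})"
    proof cases
      case 1
      then show ?thesis using run im[of i] v'(1)[of i] v'(1)[of "Suc i"] by (simp add: stack_run_def)
    next
      case 2
      then show ?thesis using new im[of L] v' by simp
    qed
  qed (use run assms(2) v' in \<open>auto simp: stack_run_def le_Suc_eq\<close>)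
qed

lemma dfs_state_stacks:
  assumes "dfs_state E r vs st"
  shows "vs \<noteq> [] \<and> (\<exists>S. S (length vs - 1) = st \<and> stack_run E r (length vs - 1) ((!) vs) S)"
  using assms
proof (induction rule: dfs_state.induct)
  case start
  show ?case by (auto intro!: exI[of _ "\<lambda>_. [r]"] simp: stack_run_def)
next
  case (descend vs u st v)
  then obtain S n where S: "S n = u # st" "stack_run E r n ((!) vs) S" and n: "length vs = Suc n"
    by (metis One_nat_def Suc_pred length_greater_0_conv)
  have "vs ! n = u" using S by (force simp: stack_run_def)
  moreover have "(!) vs ` {..n} = set vs"
    using nth_image[of "Suc n" vs] n by (simp add: atLeast0LessThan lessThan_Suc_atMost)
  ultimately have "stack_run E r (Suc n) ((!) (vs @ [v])) (S(Suc n := v # u # st))"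
    using S n descend.hyps by (intro stack_run_extend) (auto simp: nth_append)
  then show ?case using n by (auto intro!: exI[of _ "S(Suc n := v # u # st)"])
next
  case (backtrack vs u u' st)
  then obtain S n where S: "S n = u # u' # st" "stack_run E r n ((!) vs) S" and n: "length vs = Suc n"
    by (metis One_nat_def Suc_pred length_greater_0_conv)
  have "vs ! n = u" using S by (force simp: stack_run_def)
  moreover have "(!) vs ` {..n} = set vs"
    using nth_image[of "Suc n" vs] n by (simp add: atLeast0LessThan lessThan_Suc_atMost)
  ultimately have "stack_run E r (Suc n) ((!) (vs @ [u'])) (S(Suc n := u' # st))"
    using S n backtrack.hyps by (intro stack_run_extend) (auto simp: nth_append)
  then show ?case using n by (auto intro!: exI[of _ "S(Suc n := u' # st)"])
qed

section \<open>Lengths of walks\<close>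

lemma walk_len_single [simp]: "walk_len w [x] = 0"
  by (simp add: walk_len_def)

lemma walk_len_Cons: "p \<noteq> [] \<Longrightarrow> walk_len w (x # p) = w {x, hd p} + walk_len w p"
proof -
  assume "p \<noteq> []"
  then obtain y q where p: "p = y # q" by (cases p) auto
  show ?thesis by (simp add: p walk_len_def sum.lessThan_Suc_shift del: sum.lessThan_Suc)
qed

lemma walk_len_snoc: "p \<noteq> [] \<Longrightarrow> walk_len w (p @ [x]) = walk_len w p + w {last p, x}"
proof -
  assume p: "p \<noteq> []"
  then obtain n where n: "length p = Suc n" by (cases p) auto
  have "(\<Sum>i<n. w {(p @ [x]) ! i, (p @ [x]) ! Suc i}) = (\<Sum>i<n. w {p ! i, p ! Suc i})"
    using n by (intro sum.cong) (auto simp: nth_append)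
  then show ?thesis using p n by (simp add: walk_len_def nth_append last_conv_nth)
qed

lemma walk_len_rev: "walk_len w (rev p) = walk_len w p"
proof (induction p)
  case (Cons x p)
  then show ?case
    by (cases "p = []") (auto simp: walk_len_Cons walk_len_snoc last_rev insert_commute)
qed simp

lemma walk_len_segment_self: "walk_len w (segment vs a a) = 0"
  by (simp add: segment_def)

lemma walk_len_segment_Suc:
  "a \<le> i \<Longrightarrow> walk_len w (segment vs a (Suc i)) = walk_len w (segment vs a i) + w {vs ! i, vs ! Suc i}"
  using walk_len_snoc[of "map ((!) vs) [a..<Suc i]"] by (simp add: segment_def)

section \<open>Discovery and finishing times\<close>

locale dfs_run =
  fixes V :: "'a set" and E :: "'a set set" and r :: 'a and L :: nat
    and v :: "nat \<Rightarrow> 'a" and S :: "nat \<Rightarrow> 'a list"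
    and w :: "'a set \<Rightarrow> real" and H :: real
  assumes tree: "finite_tree V E"
    and run: "stack_run E r L v S" and S_L: "S L = [r]"
    and V_eq: "V = v ` {..L}"
    and w_pos: "e \<in> E \<Longrightarrow> 0 < w e" and H_pos: "0 < H"
    and tree_dist_le: "u \<in> V \<Longrightarrow> tree_dist V E w r u \<le> H"
begin

lemma S_0: "S 0 = [r]"
  and hd_S: "i \<le> L \<Longrightarrow> S i \<noteq> [] \<and> hd (S i) = v i"
  and step: "i < L \<Longrightarrow>
      S (Suc i) = v (Suc i) # S i \<and> {v i, v (Suc i)} \<in> E \<and> v (Suc i) \<notin> v ` {..i} \<or>
      S i = v i # S (Suc i) \<and> (\<forall>u. {v i, u} \<in> E \<longrightarrow> u \<in> v ` {..i})"
  using run by (simp_all add: stack_run_def)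

lemma step_cases [consumes 1, case_names push pop]:
  assumes "i < L"
  obtains "S (Suc i) = v (Suc i) # S i" "{v i, v (Suc i)} \<in> E" "v (Suc i) \<notin> v ` {..i}"
  | "S i = v i # S (Suc i)" "\<And>u. {v i, u} \<in> E \<Longrightarrow> u \<in> v ` {..i}"
  using step[OF assms] by blast

lemma v_0: "v 0 = r"
  using hd_S[of 0] S_0 by simp

lemma S_inv:
  assumes "i \<le> L"
  shows "set (S i) \<subseteq> v ` {..i} \<and> distinct (S i) \<and> last (S i) = r \<and>
    successively (\<lambda>a b. {a, b} \<in> E) (S i)"
  using assms
proof (induction i)
  case 0
  then show ?case using v_0 by (simp add: S_0)
next
  case (Suc i)
  then have IH: "set (S i) \<subseteq> v ` {..i}" "distinct (S i)" "last (S i) = r"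
    "successively (\<lambda>a b. {a, b} \<in> E) (S i)" and "i < L" by auto
  have hd: "S i \<noteq> []" "hd (S i) = v i" using hd_S[of i] Suc.prems by auto
  from \<open>i < L\<close> show ?case
  proof (cases rule: step_cases)
    case push
    then show ?thesis using IH hd by (auto simp: successively_Cons insert_commute)
  next
    case pop
    have "S (Suc i) \<noteq> []" using hd_S[OF Suc.prems] by simp
    then show ?thesis using IH pop(1) by (auto simp: successively_Cons)
  qed
qed

lemma S_ne: "i \<le> L \<Longrightarrow> S i \<noteq> []" and S_hd: "i \<le> L \<Longrightarrow> hd (S i) = v i"
  and S_sub: "i \<le> L \<Longrightarrow> set (S i) \<subseteq> v ` {..i}" and S_distinct: "i \<le> L \<Longrightarrow> distinct (S i)"
  and S_last: "i \<le> L \<Longrightarrow> last (S i) = r"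
  using hd_S S_inv by auto

lemma r_in_S: "i \<le> L \<Longrightarrow> r \<in> set (S i)"
  using S_last[of i] S_ne[of i] last_in_set by fastforce

lemma v_in_S: "i \<le> L \<Longrightarrow> v i \<in> set (S i)"
  using S_hd[of i] S_ne[of i] hd_in_set by fastforce

lemma v_r: "i \<le> L \<Longrightarrow> v i = r \<Longrightarrow> S i = [r]"
  using S_hd[of i] S_ne[of i] S_distinct[of i] S_last[of i]
  by (cases "S i") (auto split: if_splits dest: last_in_set)

definition U :: "'a set" where "U = V - {r}"

text \<open>Step \<open>a\<close> is the one that first reaches \<open>u\<close>, and step
  \<open>b\<close> the first that removes it from the stack. In between, the stack below
  \<open>u\<close> is frozen; afterwards \<open>u\<close> is visited and can never be pushed
  again.\<close>

lemma exists_times: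
  assumes "u \<in> U"
  shows "\<exists>a b. a < b \<and> b < L \<and> S (Suc a) = u # S a \<and> {v a, u} \<in> E \<and> S b = u # S a \<and> S (Suc b) = S a
    \<and> (\<forall>x. {u, x} \<in> E \<longrightarrow> x \<in> v ` {..b}) \<and> (\<forall>t\<le>L. u \<in> set (S t) \<longleftrightarrow> a < t \<and> t \<le> b)"
proof -
  have ur: "u \<noteq> r" and "u \<in> V" using assms by (auto simp: U_def)
  then obtain k where k: "k \<le> L" "v k = u" unfolding V_eq by auto
  define i where "i = (LEAST i. v i = u)"
  have i: "v i = u" "i \<le> L" and min: "\<And>j. v j = u \<Longrightarrow> i \<le> j"
    using k LeastI[of "\<lambda>i. v i = u" k] Least_le[of "\<lambda>i. v i = u"] unfolding i_def
    by (auto intro: order_trans)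
  obtain a where a: "i = Suc a" using i ur v_0 by (cases i) auto
  have new: "u \<notin> v ` {..a}" using min a by fastforce
  have aL: "a < L" using a i by simp
  have push: "S (Suc a) = u # S a \<and> {v a, u} \<in> E"
    using aL
  proof (cases rule: step_cases)
    case push
    then show ?thesis using a i by simp
  next
    case pop
    then have "u \<in> set (S a)" using v_in_S[of i] i a by simp
    then show ?thesis using S_sub[of a] new aL by auto
  qed
  have before: "u \<notin> set (S t)" if "t \<le> a" for t
    using S_sub[of t] new that aL by fastforce
  define c where "c = (LEAST t. a < t \<and> t \<le> L \<and> u \<notin> set (S t))"
  have "a < L \<and> L \<le> L \<and> u \<notin> set (S L)" using aL S_L ur by simp
  then have c: "a < c" "c \<le> L" "u \<notin> set (S c)"
    and cmin: "\<And>t. a < t \<Longrightarrow> t < c \<Longrightarrow> u \<in> set (S t)"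
    unfolding c_def using LeastI[of "\<lambda>t. a < t \<and> t \<le> L \<and> u \<notin> set (S t)" L]
      not_less_Least[of _ "\<lambda>t. a < t \<and> t \<le> L \<and> u \<notin> set (S t)"] 
    by (blast, blast, blast, metis (mono_tags, lifting) le_trans less_imp_le)
  have "c \<noteq> Suc a" using c push by auto
  then obtain b where b: "c = Suc b" "a < b" using c by (cases c) auto
  have suffix: "\<exists>ys. S t = ys @ u # S a" if "Suc a \<le> t" "t \<le> b" for t
    using that
  proof (induction t rule: dec_induct)
    case base
    then show ?case using push by simp
  next
    case (step t)
    then obtain ys where ys: "S t = ys @ u # S a" by auto
    have "t < L" using step b c by simp
    then show ?case
    proof (cases rule: step_cases)
      case push
      then show ?thesis using ys by (intro exI[of _ "v (Suc t) # ys"]) simp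
    next
      case pop
      have "u \<in> set (S (Suc t))" using cmin[of "Suc t"] step b by simp
      then have "ys \<noteq> []" using pop ys before[of a] by auto
      then show ?thesis using pop ys by (intro exI[of _ "tl ys"]) (cases ys, auto)
    qed
  qed
  then obtain ys where ys: "S b = ys @ u # S a" using b by (metis Suc_leI order_refl)
  have bL: "b < L" using b c by simp
  have pop: "S b = u # S (Suc b) \<and> (\<forall>x. {u, x} \<in> E \<longrightarrow> x \<in> v ` {..b})"
    using bL
  proof (cases rule: step_cases)
    case push
    then show ?thesis using cmin[of b] c b by auto
  next
    case pop
    then have "u = v b" using cmin[of b] c b by auto
    then show ?thesis using pop by auto
  qed
  \<comment> \<open>At \<open>b\<close> the head of the stack is \<open>u\<close>, and since stacks
    are distinct this is the occurrence directly above \<open>S a\<close>.\<close>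
  have "ys = []"
  proof (cases ys)
    case (Cons y ys')
    then have "y = u" using ys pop by simp
    then show ?thesis using S_distinct[of b] ys Cons bL by simp
  qed simp
  then have pop': "S b = u # S a" "S (Suc b) = S a" using ys pop by auto
  have after: "u \<notin> set (S t)" if "Suc b \<le> t" "t \<le> L" for t
    using that
  proof (induction t rule: dec_induct)
    case base
    then show ?case using c b by simp
  next
    case (step t)
    have "t < L" using step by simp
    then show ?case
    proof (cases rule: step_cases)
      case push
      have "i \<le> t" using a b step.hyps by linarith
      then have "u \<in> v ` {..t}" using i(1) by blast
      then have "v (Suc t) \<noteq> u" using push(3) by metis
      then show ?thesis using push(1) step.IH step.prems by simp
    next
      case pop
      then show ?thesis using step by auto
    qed
  qed
  have alive: "u \<in> set (S t) \<longleftrightarrow> a < t \<and> t \<le> b" if "t \<le> L" for t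
    using before[of t] after[of t] cmin[of t] b that by (meson leI le_imp_less_Suc not_less_eq_eq)
  show ?thesis
    using push pop pop' alive bL b by blast
qed

definition times :: "'a \<Rightarrow> nat \<times> nat" where
  "times u = (SOME (a, b). a < b \<and> b < L \<and> S (Suc a) = u # S a \<and> {v a, u} \<in> E \<and> S b = u # S a \<and> S (Suc b) = S a
    \<and> (\<forall>x. {u, x} \<in> E \<longrightarrow> x \<in> v ` {..b}) \<and> (\<forall>t\<le>L. u \<in> set (S t) \<longleftrightarrow> a < t \<and> t \<le> b))"

definition d :: "'a \<Rightarrow> nat" where "d u = fst (times u)"
definition f :: "'a \<Rightarrow> nat" where "f u = snd (times u)"

lemma
  assumes "u \<in> U"
  shows d_less_f: "d u < f u" and f_less_L: "f u < L"
    and S_Suc_d: "S (Suc (d u)) = u # S (d u)" and edge_d: "{v (d u), u} \<in> E"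
    and S_f: "S (f u) = u # S (d u)" and S_Suc_f: "S (Suc (f u)) = S (d u)"
    and nbrs_f: "\<And>x. {u, x} \<in> E \<Longrightarrow> x \<in> v ` {..f u}"
    and alive: "\<And>t. t \<le> L \<Longrightarrow> u \<in> set (S t) \<longleftrightarrow> d u < t \<and> t \<le> f u"
proof -
  obtain a b where ab: "a < b \<and> b < L \<and> S (Suc a) = u # S a \<and> {v a, u} \<in> E \<and> S b = u # S a \<and> S (Suc b) = S a
    \<and> (\<forall>x. {u, x} \<in> E \<longrightarrow> x \<in> v ` {..b}) \<and> (\<forall>t\<le>L. u \<in> set (S t) \<longleftrightarrow> a < t \<and> t \<le> b)"
    using exists_times[OF assms] by blast
  have "case times u of (a, b) \<Rightarrow> a < b \<and> b < L \<and> S (Suc a) = u # S a \<and> {v a, u} \<in> E \<and> S b = u # S a \<and> S (Suc b) = S a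
    \<and> (\<forall>x. {u, x} \<in> E \<longrightarrow> x \<in> v ` {..b}) \<and> (\<forall>t\<le>L. u \<in> set (S t) \<longleftrightarrow> a < t \<and> t \<le> b)"
    unfolding times_def by (rule someI[of _ "(a, b)"]) (use ab in simp)
  then show "d u < f u" "f u < L" "S (Suc (d u)) = u # S (d u)" "{v (d u), u} \<in> E"
    "S (f u) = u # S (d u)" "S (Suc (f u)) = S (d u)" "\<And>x. {u, x} \<in> E \<Longrightarrow> x \<in> v ` {..f u}"
    "\<And>t. t \<le> L \<Longrightarrow> u \<in> set (S t) \<longleftrightarrow> d u < t \<and> t \<le> f u"
    by (auto simp: d_def f_def split: prod.splits)
qed

lemma d_less_L: "u \<in> U \<Longrightarrow> d u < L"
  using d_less_f f_less_L less_trans by blast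

lemma r_V: "r \<in> V"
  using v_0 by (auto simp: V_eq intro: image_eqI[of _ _ 0])

lemma v_V: "i \<le> L \<Longrightarrow> v i \<in> V"
  by (simp add: V_eq)

lemma finite_V: "finite V"
  by (simp add: V_eq)

section \<open>Stacks as the paths to the root\<close>

definition par :: "'a \<Rightarrow> 'a" where "par u = v (d u)"

definition stk :: "'a \<Rightarrow> 'a list" where
  "stk u = (if u = r then [r] else u # S (d u))"

text \<open>The stack depends only on the current vertex: the part below it has not changed since
  its discovery, and nothing lies above it.\<close>

lemma S_stk:
  assumes "t \<le> L"
  shows "S t = stk (v t)"
proof (cases "v t = r")
  case True
  then show ?thesis using v_r assms by (simp add: stk_def)
next
  case False
  then have u: "v t \<in> U" using v_V assms by (simp add: U_def)
  have bnd: "d (v t) < t \<and> t \<le> f (v t)" using alive[OF u assms] v_in_S[OF assms] by simp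
  have "\<exists>ys. S s = ys @ v t # S (d (v t))" if "Suc (d (v t)) \<le> s" "s \<le> t" for s
    using that
  proof (induction s rule: dec_induct)
    case base
    then show ?case using S_Suc_d[OF u] by simp
  next
    case (step s)
    then obtain ys where ys: "S s = ys @ v t # S (d (v t))" by auto
    have "s < L" using step assms by simp
    then show ?case
    proof (cases rule: step_cases)
      case push
      then show ?thesis using ys by (intro exI[of _ "v (Suc s) # ys"]) simp
    next
      case pop
      have "v t \<in> set (S (Suc s))" using alive[OF u, of "Suc s"] step bnd assms by simp
      moreover have "v t \<notin> set (S (d (v t)))" using alive[OF u, of "d (v t)"] d_less_L[OF u] by simp
      ultimately have "ys \<noteq> []" using pop ys by auto
      then show ?thesis using pop ys by (intro exI[of _ "tl ys"]) (cases ys, auto)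
    qed
  qed
  then obtain ys where ys: "S t = ys @ v t # S (d (v t))" using bnd by (meson Suc_leI order_refl)
  have "ys = []"
  proof (cases ys)
    case (Cons y ys')
    then have "y = v t" using S_hd[OF assms] ys by simp
    then show ?thesis using S_distinct[OF assms] ys Cons by simp
  qed simp
  then show ?thesis using ys False by (simp add: stk_def)
qed

lemma stk_r [simp]: "stk r = [r]"
  by (simp add: stk_def)

lemma par_V: "u \<in> U \<Longrightarrow> par u \<in> V"
  unfolding par_def using d_less_L by (intro v_V) (simp add: less_imp_le)

lemma stk_Cons: "u \<in> U \<Longrightarrow> stk u = u # stk (par u)"
  using S_stk[of "d u"] d_less_L[of u] by (auto simp: stk_def[of u] par_def U_def)

lemma stk_S: "u \<in> V \<Longrightarrow> \<exists>t\<le>L. v t = u \<and> stk u = S t"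
  using S_stk by (auto simp: V_eq)

lemma hd_stk: "hd (stk u) = u" and stk_ne [simp]: "stk u \<noteq> []"
  by (auto simp: stk_def)

lemma last_stk: "u \<in> V \<Longrightarrow> last (stk u) = r" and distinct_stk: "u \<in> V \<Longrightarrow> distinct (stk u)"
  and set_stk: "u \<in> V \<Longrightarrow> set (stk u) \<subseteq> V"
  and successively_stk: "u \<in> V \<Longrightarrow> successively (\<lambda>a b. {a, b} \<in> E) (stk u)"
  using stk_S[of u] S_inv by (auto simp: V_eq) fastforce+

lemma self_stk: "u \<in> set (stk u)"
  by (simp add: stk_def)

lemma edge_neq: "{a, b} \<in> E \<Longrightarrow> a \<in> V \<and> b \<in> V \<and> a \<noteq> b"
  using tree by (fastforce simp: finite_tree_def simple_graph_def doubleton_eq_iff)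

text \<open>Otherwise the edge closes a cycle with the part of the stack between \<open>b\<close> and \<open>a\<close>.\<close>

lemma ancestor_edge:
  assumes "{a, b} \<in> E" "b \<in> U" "a \<in> set (S (d b))"
  shows "a = par b"
proof (rule ccontr)
  assume ne: "a \<noteq> par b"
  obtain ys zs where yz: "S (d b) = ys @ a # zs" using assms(3) by (meson split_list)
  have L: "d b < L" using d_less_L assms by simp
  have "ys \<noteq> []" using yz ne S_hd[of "d b"] L by (auto simp: par_def)
  have full: "S (Suc (d b)) = (b # ys @ [a]) @ zs" using yz S_Suc_d[OF assms(2)] by simp
  let ?c = "b # ys @ [a]"
  have "set (S (Suc (d b))) \<subseteq> V" "distinct (S (Suc (d b)))"
    "successively (\<lambda>a b. {a, b} \<in> E) (S (Suc (d b)))"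
    using S_inv[of "Suc (d b)"] L by (auto simp: V_eq)
  then have "is_walk V E ?c" "distinct ?c"
    unfolding full is_walk_def successively_append_iff by auto
  moreover have "length ?c \<ge> 3" using \<open>ys \<noteq> []\<close> by (cases ys) auto
  ultimately have "is_cycle V E ?c" using assms(1) by (simp add: is_cycle_def)
  then show False using tree by (auto simp: finite_tree_def)
qed

text \<open>The search leaves a vertex only when all its neighbours are visited, so the endpoint
  discovered later is found while the other one is on the stack. Then \<open>ancestor_edge\<close>
  applies.\<close>

lemma edge_par:
  assumes "{a, b} \<in> E"
  shows "b \<in> U \<and> a = par b \<or> a \<in> U \<and> b = par a"
proof -
  have later: "b \<in> U \<and> a = par b"
    if e: "{a, b} \<in> E" and ord: "b \<in> U" "a = r \<or> a \<in> U \<and> d a < d b" for a b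
  proof -
    have L: "d b < L" using d_less_L e ord by simp
    have "a \<in> set (S (d b))"
    proof (cases "a = r")
      case True
      then show ?thesis using r_in_S[of "d b"] L by simp
    next
      case False
      then have a: "a \<in> U" "d a < d b" using ord by auto
      obtain i where i: "i \<le> f a" "b = v i" using nbrs_f[OF a(1) e] by auto
      have "d b < i" using alive[OF ord(1), of i] v_in_S[of i] i f_less_L[OF a(1)] by simp
      then show ?thesis using alive[OF a(1), of "d b"] a i L by simp
    qed
    then show ?thesis using ancestor_edge e ord by blast
  qed
  have V: "a \<in> V" "b \<in> V" "a \<noteq> b" using edge_neq[OF assms] by auto
  have inj: "d a \<noteq> d b" if "a \<in> U" "b \<in> U"
    using S_Suc_d[OF that(1)] S_Suc_d[OF that(2)] V by auto
  consider "a = r" "b \<in> U" | "b = r" "a \<in> U" | "a \<in> U" "b \<in> U"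
    using V by (auto simp: U_def)
  then show ?thesis
  proof cases
    case 3
    then consider "d a < d b" | "d b < d a" using inj by force
    then show ?thesis using later[of a b] later[of b a] 3 assms by cases (auto simp: insert_commute)
  qed (use later[of a b] later[of b a] assms in \<open>auto simp: insert_commute\<close>)
qed

lemma par_edge: "u \<in> U \<Longrightarrow> {par u, u} \<in> E"
  using edge_d by (simp add: par_def)

text \<open>By induction from the far end: the last edge joins a vertex to its parent, and if it led
  upwards, \<open>u\<close> would already lie on the path.\<close>

lemma path_root_unique:
  assumes "is_path_between V E r p u"
  shows "p = rev (stk u)"
  using assms
proof (induction p arbitrary: u rule: rev_induct)
  case Nil
  then show ?case by (simp add: is_path_between_def is_walk_def)
next
  case (snoc y q)
  then have [simp]: "y = u" by (simp add: is_path_between_def)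
  show ?case
  proof (cases "q = []")
    case True
    then show ?thesis using snoc.prems by (auto simp: is_path_between_def)
  next
    case False
    have "is_path_between V E r q (last q)"
      using snoc.prems False
      by (auto simp: is_path_between_def is_walk_def successively_append_iff)
    then have q: "q = rev (stk (last q))" by (rule snoc.IH)
    have e: "{last q, u} \<in> E" and un: "u \<notin> set q"
      using snoc.prems False by (auto simp: is_path_between_def is_walk_def successively_append_iff)
    from edge_par[OF e] show ?thesis
    proof
      assume "u \<in> U \<and> last q = par u"
      then show ?thesis using q stk_Cons[of u] by simp
    next
      assume "last q \<in> U \<and> u = par (last q)"
      then have "u \<in> set (stk (last q))" using stk_Cons[of "last q"] self_stk[of u] by simp
      then show ?thesis using un q by (metis set_rev)
    qed
  qed
qed

lemma stk_path: "u \<in> V \<Longrightarrow> is_path_between V E r (rev (stk u)) u"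
  using set_stk[of u] distinct_stk[of u] successively_stk[of u] last_stk[of u] hd_stk[of u]
  by (auto simp: is_path_between_def is_walk_def hd_rev last_rev insert_commute)

lemma tree_path_root: "u \<in> V \<Longrightarrow> tree_path V E r u = rev (stk u)"
  unfolding tree_path_def using stk_path path_root_unique by blast

lemma path_rev: "is_path_between V E u p r \<longleftrightarrow> is_path_between V E r (rev p) u"
  by (auto simp: is_path_between_def is_walk_def hd_rev last_rev insert_commute)

lemma tree_path_to_root: "u \<in> V \<Longrightarrow> tree_path V E u r = stk u"
  unfolding tree_path_def
  using stk_path path_root_unique by (intro the_equality) (auto simp: path_rev rev_swap)

section \<open>Edge weights and distances from the root\<close>

definition l :: "'a \<Rightarrow> real" where "l u = w {par u, u}"

definition dist :: "'a \<Rightarrow> real" where "dist u = sum l (set (stk u) - {r})"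

lemma l_pos: "u \<in> U \<Longrightarrow> 0 < l u"
  unfolding l_def by (rule w_pos[OF par_edge])

lemma dist_r [simp]: "dist r = 0"
  by (simp add: dist_def)

lemma U_V: "u \<in> U \<Longrightarrow> u \<in> V" and U_neq_r: "u \<in> U \<Longrightarrow> u \<noteq> r"
  by (auto simp: U_def)

lemma dist_par:
  assumes "u \<in> U"
  shows "dist u = dist (par u) + l u"
proof -
  have "u \<notin> set (stk (par u))" using distinct_stk[OF U_V[OF assms]] stk_Cons[OF assms] by simp
  moreover have "set (stk u) - {r} = insert u (set (stk (par u)) - {r})"
    using stk_Cons[OF assms] U_neq_r[OF assms] by auto
  ultimately show ?thesis by (simp add: dist_def)
qed

lemma walk_len_stk: "u \<in> V \<Longrightarrow> walk_len w (stk u) = dist u"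
proof (induction "length (stk u)" arbitrary: u rule: less_induct)
  case less
  show ?case
  proof (cases "u = r")
    case False
    then have u: "u \<in> U" using less.prems by (simp add: U_def)
    have "walk_len w (stk (par u)) = dist (par u)"
      using less.hyps[of "par u"] stk_Cons[OF u] par_V[OF u] by simp
    then show ?thesis
      using stk_Cons[OF u] dist_par[OF u] by (simp add: walk_len_Cons hd_stk l_def insert_commute)
  qed simp
qed

lemma tree_dist_eq: "u \<in> V \<Longrightarrow> tree_dist V E w r u = dist u" "u \<in> V \<Longrightarrow> tree_dist V E w u r = dist u"
  by (simp_all add: tree_dist_def tree_path_root tree_path_to_root walk_len_rev walk_len_stk)

lemma anc_eq:
  assumes "u \<in> U"
  shows "{x \<in> U. d x \<le> d u \<and> d u < f x} = set (stk u) - {r}"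
proof -
  have "stk u = S (Suc (d u))" using S_Suc_d[OF assms] U_neq_r[OF assms] by (simp add: stk_def)
  then have "x \<in> set (stk u) \<longleftrightarrow> d x \<le> d u \<and> d u < f x" if "x \<in> U" for x
    using alive[OF that, of "Suc (d u)"] d_less_L[OF assms] by (simp add: less_Suc_eq_le Suc_le_eq)
  then show ?thesis using set_stk[OF U_V[OF assms]] by (auto simp: U_def)
qed

lemma step_dist:
  assumes "Suc i \<le> L"
  shows "w {v i, v (Suc i)} = \<bar>dist (v (Suc i)) - dist (v i)\<bar>"
proof -
  have e: "{v i, v (Suc i)} \<in> E"
  proof -
    have "i < L" using assms by simp
    then show ?thesis
    proof (cases rule: step_cases)
      case pop
      have "successively (\<lambda>a b. {a, b} \<in> E) (S i)" using S_inv[of i] assms by simp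
      then show ?thesis
        using pop S_hd[of "Suc i"] S_ne[of "Suc i"] assms by (auto simp: successively_Cons)
    qed
  qed
  from edge_par[OF e] show ?thesis
  proof
    assume "v (Suc i) \<in> U \<and> v i = par (v (Suc i))"
    then show ?thesis using dist_par[of "v (Suc i)"] l_pos[of "v (Suc i)"] by (simp add: l_def)
  next
    assume "v i \<in> U \<and> v (Suc i) = par (v i)"
    then show ?thesis using dist_par[of "v i"] l_pos[of "v i"] by (simp add: l_def insert_commute)
  qed
qed

text \<open>A step away from the root raises both the length and the final distance by the edge
  weight, which pays twice for a new vertex. A step towards the root visits nothing new and leaves
  the sum of length and distance unchanged. For closed walks the distance term is 0.\<close>

lemma walk_weight:
  assumes "is_walk V E p" "hd p = r"
  shows "(\<forall>u\<in>set p. set (stk u) \<subseteq> set p) \<and>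
    2 * sum l (set p - {r}) \<le> walk_len w p + dist (last p)"
  using assms
proof (induction p rule: rev_induct)
  case Nil
  then show ?case by (simp add: is_walk_def)
next
  case (snoc b p)
  show ?case
  proof (cases "p = []")
    case True
    then show ?thesis using snoc.prems by simp
  next
    case False
    then have IH: "\<And>u. u \<in> set p \<Longrightarrow> set (stk u) \<subseteq> set p"
      "2 * sum l (set p - {r}) \<le> walk_len w p + dist (last p)"
      using snoc by (auto simp: is_walk_def successively_append_iff)
    have e: "{last p, b} \<in> E"
      using snoc.prems False by (simp add: is_walk_def successively_append_iff)
    have last: "last p \<in> set p" using False by simp
    from edge_par[OF e] show ?thesis
    proof
      assume b: "b \<in> U \<and> last p = par b"
      then have "w {last p, b} = l b" by (simp add: l_def)
      moreover have "set (p @ [b]) - {r} = insert b (set p - {r})" using b U_neq_r[of b] by auto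
      moreover have "sum l (insert b (set p - {r})) \<le> sum l (set p - {r}) + l b"
        using b l_pos[of b] U_neq_r[of b] by (cases "b \<in> set p") (auto simp: insert_absorb)
      ultimately show ?thesis
        using IH last b stk_Cons[of b] dist_par[of b] False by (auto simp: walk_len_snoc)
    next
      assume b: "last p \<in> U \<and> b = par (last p)"
      then have "b \<in> set p"
        using IH(1)[OF last] stk_Cons[of "last p"] self_stk[of b] by auto
      moreover from this have "set (p @ [b]) - {r} = set p - {r}" by auto
      moreover have "w {last p, b} = l (last p)" using b by (simp add: l_def insert_commute)
      ultimately show ?thesis
        using IH b dist_par[of "last p"] False by (auto simp: walk_len_snoc)
    qed
  qed
qed

section \<open>Application of the abstract bound to the traversal\<close>

lemma dfs_word:
  assumes "exploration_strategy V E w r (2 * H) Rs"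
  shows "dfs_word U d f l H L (\<lambda>j. set (Rs ! j) - {r}) (length Rs)"
proof -
  have route: "is_walk V E (Rs ! j)" "hd (Rs ! j) = r" "last (Rs ! j) = r" "walk_len w (Rs ! j) \<le> 2 * H"
    if "j < length Rs" for j
    using assms nth_mem[OF that] by (auto simp: exploration_strategy_def is_route_def)
  have anc: "set (stk u) \<subseteq> set (Rs ! j)" if "j < length Rs" "u \<in> set (Rs ! j)" for j u
    using walk_weight[OF route(1,2)] that by blast
  show ?thesis
  proof
    show "finite U" using finite_V by (simp add: U_def)
    show "inj_on d U"
      using S_Suc_d by (intro inj_onI) (metis list.inject)
    show "inj_on f U"
      using S_f by (intro inj_onI) (metis list.inject)
    show "d ` U \<inter> f ` U = {}"
    proof -
      have "d x \<noteq> f y" if "x \<in> U" "y \<in> U" for x y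
      proof
        assume "d x = f y"
        \<comment> \<open>A single step would have to both push \<open>x\<close> and pop
          \<open>y\<close>.\<close>
        then have "x # y # S (d y) = S (d y)"
          using S_Suc_d[OF that(1)] S_f[OF that(2)] S_Suc_f[OF that(2)] by simp
        then have "length (x # y # S (d y)) = length (S (d y))" by (rule arg_cong)
        then show False by simp
      qed
      then show ?thesis by auto
    qed
    show "d ` U \<union> f ` U = {..<L}"
    proof (intro equalityI subsetI)
      fix t assume "t \<in> {..<L}"
      then have t: "t < L" by simp
      then show "t \<in> d ` U \<union> f ` U"
      proof (cases rule: step_cases)
        case push
        have "v (Suc t) \<noteq> r" using push(3) v_0 by (metis atMost_iff image_eqI zero_le)
        then have u: "v (Suc t) \<in> U" using v_V[of "Suc t"] t by (simp add: U_def)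
        have "v (Suc t) \<in> set (S (Suc t))" "v (Suc t) \<notin> set (S t)"
          using push S_sub[of t] t by auto
        then have "d (v (Suc t)) = t"
          using alive[OF u, of t] alive[OF u, of "Suc t"] t by auto
        then show ?thesis using u by (metis UnI1 image_eqI)
      next
        case pop
        have "v t \<notin> set (S (Suc t))" using S_distinct[of t] pop t by simp
        then have "v t \<noteq> r" using r_in_S[of "Suc t"] t by auto
        then have u: "v t \<in> U" using v_V[of t] t by (simp add: U_def)
        have "f (v t) = t"
          using alive[OF u, of t] alive[OF u, of "Suc t"] t v_in_S[of t] \<open>v t \<notin> set (S (Suc t))\<close> by auto
        then show ?thesis using u by (metis UnI2 image_eqI)
      qed
    qed (use d_less_L f_less_L in auto)
    show "d u < f u" if "u \<in> U" for u using d_less_f[OF that] .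
    show "f u < f x" if "u \<in> U" "x \<in> U" "d x < d u" "d u < f x" for u x
    proof -
      \<comment> \<open>Leaving \<open>u\<close> restores the stack from before its discovery, which
        still contains \<open>x\<close>.\<close>
      have "x \<in> set (S (d u))" using alive[OF that(2), of "d u"] that d_less_L[OF that(1)] by simp
      then have "x \<in> set (S (Suc (f u)))" using S_Suc_f[OF that(1)] by simp
      then show ?thesis using alive[OF that(2), of "Suc (f u)"] f_less_L[OF that(1)] by simp
    qed
    show "0 < l u" if "u \<in> U" for u using l_pos[OF that] .
    show "0 < H" by (rule H_pos)
    show "(\<Sum>x\<in>{x \<in> U. d x \<le> d u \<and> d u < f x}. l x) \<le> H" if "u \<in> U" for u
      using tree_dist_le[OF U_V[OF that]] tree_dist_eq(1)[OF U_V[OF that]] anc_eq[OF that]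
      by (simp add: dist_def)
    show "set (Rs ! j) - {r} \<subseteq> U" if "j < length Rs" for j
      using route(1)[OF that] by (auto simp: is_walk_def U_def)
    then show "x \<in> set (Rs ! j) - {r}"
      if "j < length Rs" "u \<in> set (Rs ! j) - {r}" "x \<in> U" "d x \<le> d u" "d u < f x" for j u x
      using anc_eq[of u] anc[of j u] that by blast
    show "sum l (set (Rs ! j) - {r}) \<le> H" if "j < length Rs" for j
      using walk_weight[OF route(1,2)[OF that]] route(3,4)[OF that] by simp
    show "\<exists>j<length Rs. u \<in> set (Rs ! j) - {r}" if "u \<in> U" for u
      using assms that by (auto simp: exploration_strategy_def U_def in_set_conv_nth) (metis in_set_conv_nth)
    have "Rs \<noteq> []" using assms r_V by (auto simp: exploration_strategy_def)
    then show "0 < length Rs" by simp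
  qed
qed

lemma ht_eq:
  assumes Rs: "exploration_strategy V E w r (2 * H) Rs" and t: "t \<le> L"
  shows "dfs_word.ht U d f l t = dist (v t)"
proof -
  have "set (S t) \<subseteq> V" using S_sub[OF t] v_V t by auto
  then have "dfs_word.open_at U d f t = set (S t) - {r}"
    unfolding dfs_word.open_at_def[OF dfs_word[OF Rs]] using alive[OF _ t] by (auto simp: U_def)
  then show ?thesis using S_stk[OF t] by (simp add: dfs_word.ht_def[OF dfs_word[OF Rs]] dist_def)
qed

lemma pdfs_le:
  assumes v: "v = (!) vs" and L: "L = length vs - 1"
    and Rs: "exploration_strategy V E w r (2 * H) Rs"
  shows "length (pdfs V E w r (2 * H) vs) \<le> 10 * length Rs"
proof -
  let ?h = "dfs_word.ht U d f l"
  define idx where "idx = pdfs_index V E w r (2 * H) vs"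
  \<comment> \<open>The greedy rule sees only the heights, and each cut accounts for at most one
    further route after the first.\<close>
  have "\<exists>m. 1 \<le> m \<and> m \<le> Suc (ncuts H ?h L) \<and> idx m = L"
  proof (rule greedy_index_le[where len = "\<lambda>a b. walk_len w (segment vs a b)"])
    show "idx 0 = 0" by (simp add: idx_def)
    show "walk_len w (segment vs a a) = 0" for a by (rule walk_len_segment_self)
    show "walk_len w (segment vs a (Suc i)) =
        walk_len w (segment vs a i) + \<bar>?h (Suc i) - ?h i\<bar>" if "a \<le> i" "Suc i \<le> L" for a i
      using that step_dist[OF that(2)] ht_eq[OF Rs, of i] ht_eq[OF Rs, of "Suc i"] by (simp add: walk_len_segment_Suc v)
    fix m assume m: "idx m \<le> L"
    have "idx (Suc m) = (GREATEST p. idx m \<le> p \<and> p \<le> L \<and>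
        tree_dist V E w r (vs ! idx m) + walk_len w (segment vs (idx m) p) + tree_dist V E w (vs ! p) r \<le> 2 * H)"
      by (simp add: idx_def L Let_def)
    also have "(\<lambda>p. idx m \<le> p \<and> p \<le> L \<and>
        tree_dist V E w r (vs ! idx m) + walk_len w (segment vs (idx m) p) + tree_dist V E w (vs ! p) r \<le> 2 * H) =
      (\<lambda>p. idx m \<le> p \<and> p \<le> L \<and>
        ?h (idx m) + walk_len w (segment vs (idx m) p) + ?h p \<le> 2 * H)"
      using m v_V by (intro ext) (auto simp: tree_dist_eq ht_eq[OF Rs] v[symmetric])
    finally show "idx (Suc m) = (GREATEST p. idx m \<le> p \<and> p \<le> L \<and>
        ?h (idx m) + walk_len w (segment vs (idx m) p) + ?h p \<le> 2 * H)" .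
  qed (use dfs_word.ht_le[OF dfs_word[OF Rs]] dfs_word.ht_0[OF dfs_word[OF Rs]] in auto)
  then obtain m where m: "1 \<le> m" "m \<le> Suc (ncuts H ?h L)" "idx m = L" by auto
  have "pdfs_count V E w r (2 * H) vs \<le> m"
    unfolding pdfs_count_def using m by (intro Least_le) (simp add: idx_def L)
  then show ?thesis
    using m dfs_word.ncuts_bound[OF dfs_word[OF Rs]] by (simp add: pdfs_def)
qed

end

lemma dfs_traversal_run:
  assumes "finite_tree V E" "dfs_traversal V E r vs"
    and "\<forall>e\<in>E. w e > 0" "H > 0" "\<forall>v\<in>V. tree_dist V E w r v \<le> H"
  obtains S where "dfs_run V E r (length vs - 1) ((!) vs) S w H"
proof -
  have st: "dfs_state E r vs [r]" and V: "set vs = V" using assms(2) by (auto simp: dfs_traversal_def)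
  from dfs_state_stacks[OF st] obtain S
    where ne: "vs \<noteq> []" and S: "S (length vs - 1) = [r]" "stack_run E r (length vs - 1) ((!) vs) S"
    by blast
  have im: "V = (!) vs ` {..length vs - 1}"
    using nth_image[of "length vs" vs] ne V
    by (simp add: atLeast0LessThan lessThan_Suc_atMost[symmetric])
  have "dfs_run V E r (length vs - 1) ((!) vs) S w H"
    by (rule dfs_run.intro) (use assms in blast | rule S im)+
  then show ?thesis by (rule that)
qed

theorem theorem1:
  fixes V :: "'a set" and E :: "'a set set" and w :: "'a set \<Rightarrow> real"
    and r :: 'a and B :: real and vs :: "'a list" and Rs :: "'a list list"
  assumes "finite_tree V E"
    and "r \<in> V"
    and "\<forall>e\<in>E. w e > 0"
    and "B > 1"
    and "\<forall>v\<in>V. tree_dist V E w r v \<le> B / 2"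
    and "dfs_traversal V E r vs"
    and "min_exploration_strategy V E w r B Rs"
  shows "length (pdfs V E w r B vs) \<le> 10 * length Rs"
proof -
  obtain S where run: "dfs_run V E r (length vs - 1) ((!) vs) S w (B / 2)"
    using dfs_traversal_run[OF assms(1,6,3) _ assms(5)] assms(4) by fastforce
  have "exploration_strategy V E w r (2 * (B / 2)) Rs"
    using assms(7) by (simp add: min_exploration_strategy_def)
  from dfs_run.pdfs_le[OF run refl refl this] show ?thesis by simp
qed

end
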